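(* (Second integral representation of $s_t$.) Let $A=A^T\in\mathbb C^{n\times n}$, $B=B^*\in\mathbb C^{n\times n}$, $h\in\mathbb C^n$, and $$\widehat H=\tfrac{i}{2}\bigl((a^\dagger,Aa^\dagger)-(a,\overline A a)\bigr)+(a^\dagger,Ba)+i(a^\dagger,h)-i(a,\overline h).$$ With $\Phi_t,\Psi_t,h_t$ as in the context, put $R_t=\Phi_t^{-1}\Psi_t$ and $\widetilde f_t=h_{-t}+R_t\overline h_{-t}$. Then the function $s_t$ determined by $e^{s_t}=\langle0|e^{i\widehat Ht}|0\rangle$ (continuous in $t$, $s_0=0$) is $$s_t=\int_0^t\Bigl((\widetilde f_\tau,\overline h)+\tfrac12(\widetilde f_\tau,\overline A\widetilde f_\tau)-\tfrac12\operatorname{tr}(R_\tau\overline A)\Bigr)d\tau .$$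
   Context: $a=(a_1,\dots,a_n)$, $a^\dagger=(a_1^\dagger,\dots,a_n^\dagger)$ are the annihilation and creation operators on $\mathcal H=\otimes_1^n\ell_2$ (the $n$-mode boson Fock space), $[a_i,a_j^\dagger]=\delta_{ij}$, with vacuum $|0\rangle$. $(u,v)=\sum_iu_iv_i$ is the bilinear (not sesquilinear) form, also used for tuples of operators, e.g. $(a^\dagger,Ma)=\sum_{ij}M_{ij}a_i^\dagger a_j$; $\langle\cdot|\cdot\rangle$ is the sesquilinear inner product of $\mathcal H$. A bar is entrywise complex conjugation, $T$ is transpose, $*$ is Hermitian conjugation. $\widehat H$ denotes the self-adjoint closure of the given expression from the finite-particle vectors. Define $G=\begin{pmatrix}-iB&A\\ \overline A&i\overline B\end{pmatrix}$, and $n\times n$ blocks $\Phi_t,\Psi_t$ by $e^{Gt}=\begin{pmatrix}\Phi_t&\Psi_t\\ \overline\Psi_t&\overline\Phi_t\end{pmatrix}$; $\Phi_t$ is invertible for all $t\in\mathbb R$. The vector $h_t$ is defined for all $t\in\mathbb R$ by $\begin{pmatrix}h_t\\ \overline h_t\end{pmatrix}=\int_0^te^{G\tau}\begin{pmatrix}h\\ \overline h\end{pmatrix}d\tau$. The vacuum expectation $\langle0|e^{i\widehat Ht}|0\rangle$ never vanishes. *)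

theory Defs
  imports "HOL-Analysis.Analysis"
begin

section \<open>The \<open>n\<close>-mode boson Fock space\<close>

text \<open>
  The modes are indexed by a finite type. A vector of the Fock space is given by its amplitudes
  in the orthonormal basis of occupation number states
  \<open>|k\<rangle> = (\<Prod>i. (a\<^sub>i\<^sup>\<dagger>) ^ k i / sqrt (fact (k i))) |0\<rangle>\<close>, with \<open>k :: 'n \<Rightarrow> nat\<close>; that is, the tensor
  product of \<open>n\<close> copies of \<open>\<ell>\<^sub>2\<close> is realised as \<open>\<ell>\<^sub>2\<close> over the multi-indices.
\<close>

lemma square_summable_add:
  fixes f g :: "'a \<Rightarrow> complex"
  assumes "(\<lambda>k. (cmod (f k))\<^sup>2) summable_on UNIV" "(\<lambda>k. (cmod (g k))\<^sup>2) summable_on UNIV"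
  shows "(\<lambda>k. (cmod (f k + g k))\<^sup>2) summable_on UNIV"
proof (rule summable_on_comparison_test)
  show "(\<lambda>k. 2 * (cmod (f k))\<^sup>2 + 2 * (cmod (g k))\<^sup>2) summable_on UNIV"
    by (intro summable_on_add summable_on_cmult_right assms)
  fix k
  have "(cmod (f k + g k))\<^sup>2 \<le> (cmod (f k) + cmod (g k))\<^sup>2"
    by (intro power_mono norm_triangle_ineq) auto
  also have "\<dots> \<le> 2 * (cmod (f k))\<^sup>2 + 2 * (cmod (g k))\<^sup>2"
    using sum_squares_bound[of "cmod (f k)" "cmod (g k)"] by (simp add: power2_sum)
  finally show "(cmod (f k + g k))\<^sup>2 \<le> 2 * (cmod (f k))\<^sup>2 + 2 * (cmod (g k))\<^sup>2" .
qed auto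

lemma square_summable_scale:
  fixes f :: "'a \<Rightarrow> complex"
  assumes "(\<lambda>k. (cmod (f k))\<^sup>2) summable_on UNIV"
  shows "(\<lambda>k. (cmod (c * f k))\<^sup>2) summable_on UNIV"
  unfolding norm_mult power_mult_distrib by (intro summable_on_cmult_right assms)

lemma square_summable_inner:
  fixes f g :: "'a \<Rightarrow> complex"
  assumes "(\<lambda>k. (cmod (f k))\<^sup>2) summable_on UNIV" "(\<lambda>k. (cmod (g k))\<^sup>2) summable_on UNIV"
  shows "(\<lambda>k. cnj (f k) * g k) summable_on UNIV"
proof (rule abs_summable_summable, rule summable_on_comparison_test)
  show "(\<lambda>k. (cmod (f k))\<^sup>2 + (cmod (g k))\<^sup>2) summable_on UNIV"
    by (intro summable_on_add assms)
  fix k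
  have "2 * (cmod (f k) * cmod (g k)) \<le> (cmod (f k))\<^sup>2 + (cmod (g k))\<^sup>2"
    using sum_squares_bound[of "cmod (f k)" "cmod (g k)"] by simp
  moreover have "0 \<le> cmod (f k) * cmod (g k)" by simp
  ultimately have "cmod (f k) * cmod (g k) \<le> (cmod (f k))\<^sup>2 + (cmod (g k))\<^sup>2" by linarith
  then show "norm (cnj (f k) * g k) \<le> (cmod (f k))\<^sup>2 + (cmod (g k))\<^sup>2"
    by (simp add: norm_mult)
qed auto

typedef ('n::finite) fock =
  "{\<psi> :: ('n \<Rightarrow> nat) \<Rightarrow> complex. (\<lambda>k. (cmod (\<psi> k))\<^sup>2) summable_on UNIV}"
  morphisms amp Abs_fock
  by (rule exI[of _ "\<lambda>_. 0"]) auto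

lemma amp_summable: "(\<lambda>k. (cmod (amp \<psi> k))\<^sup>2) summable_on UNIV"
  using amp[of \<psi>] by simp

lemma amp_Abs:
  "(\<lambda>k. (cmod (f k))\<^sup>2) summable_on UNIV \<Longrightarrow> amp (Abs_fock f) = f"
  by (simp add: Abs_fock_inverse)

lemma fock_eqI: "(\<And>k. amp \<psi> k = amp \<phi> k) \<Longrightarrow> \<psi> = \<phi>"
  by (simp add: amp_inject[symmetric] ext)

definition cscale :: "complex \<Rightarrow> ('n::finite) fock \<Rightarrow> 'n fock" where
  "cscale c \<psi> = Abs_fock (\<lambda>k. c * amp \<psi> k)"

lemma amp_cscale: "amp (cscale c \<psi>) = (\<lambda>k. c * amp \<psi> k)"
  unfolding cscale_def by (intro amp_Abs square_summable_scale amp_summable)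

text \<open>The sesquilinear inner product, conjugate-linear in the first argument.\<close>

definition braket :: "('n::finite) fock \<Rightarrow> 'n fock \<Rightarrow> complex" where
  "braket \<phi> \<psi> = (\<Sum>\<^sub>\<infinity>k. cnj (amp \<phi> k) * amp \<psi> k)"

lemma braket_summable: "(\<lambda>k. cnj (amp \<phi> k) * amp \<psi> k) summable_on UNIV"
  by (intro square_summable_inner amp_summable)

instantiation fock :: (finite) real_inner
begin

definition zero_fock :: "'a fock" where "0 = Abs_fock (\<lambda>_. 0)"
definition plus_fock :: "'a fock \<Rightarrow> 'a fock \<Rightarrow> 'a fock" where
  "\<psi> + \<phi> = Abs_fock (\<lambda>k. amp \<psi> k + amp \<phi> k)"
definition uminus_fock :: "'a fock \<Rightarrow> 'a fock" where "- \<psi> = cscale (- 1) \<psi>"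
definition minus_fock :: "'a fock \<Rightarrow> 'a fock \<Rightarrow> 'a fock" where "\<psi> - \<phi> = \<psi> + (- \<phi> :: 'a fock)"
definition scaleR_fock :: "real \<Rightarrow> 'a fock \<Rightarrow> 'a fock" where "r *\<^sub>R \<psi> = cscale (of_real r) \<psi>"
definition inner_fock :: "'a fock \<Rightarrow> 'a fock \<Rightarrow> real" where "\<psi> \<bullet> \<phi> = Re (braket \<psi> \<phi>)"
definition norm_fock :: "'a fock \<Rightarrow> real" where "norm \<psi> = sqrt (\<psi> \<bullet> (\<psi> :: 'a fock))"
definition dist_fock :: "'a fock \<Rightarrow> 'a fock \<Rightarrow> real" where "dist \<psi> \<phi> = norm (\<psi> - \<phi> :: 'a fock)"
definition sgn_fock :: "'a fock \<Rightarrow> 'a fock" where "sgn \<psi> = inverse (norm \<psi>) *\<^sub>R (\<psi> :: 'a fock)"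
definition uniformity_fock :: "('a fock \<times> 'a fock) filter" where
  "uniformity = (INF e\<in>{0<..}. principal {(\<psi>, \<phi> :: 'a fock). dist \<psi> \<phi> < e})"
definition open_fock :: "'a fock set \<Rightarrow> bool" where
  "open U \<longleftrightarrow> (\<forall>\<psi>\<in>U. \<forall>\<^sub>F (\<psi>', \<phi>) in uniformity. \<psi>' = \<psi> \<longrightarrow> \<phi> \<in> (U :: 'a fock set))"

lemma amp_zero: "amp (0 :: 'a fock) = (\<lambda>_. 0)"
  unfolding zero_fock_def by (rule amp_Abs) simp

lemma amp_plus: "amp (\<psi> + \<phi> :: 'a fock) = (\<lambda>k. amp \<psi> k + amp \<phi> k)"
  unfolding plus_fock_def by (intro amp_Abs square_summable_add amp_summable)

lemma amp_uminus: "amp (- \<psi> :: 'a fock) = (\<lambda>k. - amp \<psi> k)"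
  by (simp add: uminus_fock_def amp_cscale)

lemma amp_minus: "amp (\<psi> - \<phi> :: 'a fock) = (\<lambda>k. amp \<psi> k - amp \<phi> k)"
  by (simp add: minus_fock_def amp_plus amp_uminus)

lemma amp_scaleR: "amp (r *\<^sub>R \<psi> :: 'a fock) = (\<lambda>k. of_real r * amp \<psi> k)"
  by (simp add: scaleR_fock_def amp_cscale)

lemmas amp_simps = amp_zero amp_plus amp_uminus amp_minus amp_scaleR amp_cscale

lemma Re_braket_self: "Re (braket \<psi> \<psi>) = (\<Sum>\<^sub>\<infinity>k. (cmod (amp (\<psi> :: 'a fock) k))\<^sup>2)"
  unfolding braket_def
  by (subst infsum_Re[OF braket_summable, symmetric])
     (simp add: cmod_power2 flip: power2_eq_square)

instance
proof
  fix \<psi> \<phi> \<xi> :: "'a fock" and r s :: real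
  show "\<psi> + \<phi> + \<xi> = \<psi> + (\<phi> + \<xi>)" "\<psi> + \<phi> = \<phi> + \<psi>" "0 + \<psi> = \<psi>" "- \<psi> + \<psi> = 0" "\<psi> - \<phi> = \<psi> + - \<phi>"
    "r *\<^sub>R (\<psi> + \<phi>) = r *\<^sub>R \<psi> + r *\<^sub>R \<phi>" "(r + s) *\<^sub>R \<psi> = r *\<^sub>R \<psi> + s *\<^sub>R \<psi>"
    "r *\<^sub>R s *\<^sub>R \<psi> = (r * s) *\<^sub>R \<psi>" "1 *\<^sub>R \<psi> = \<psi>"
    by (auto intro!: fock_eqI simp: amp_simps algebra_simps)
  show "dist \<psi> \<phi> = norm (\<psi> - \<phi>)" by (rule dist_fock_def)
  show "sgn \<psi> = inverse (norm \<psi>) *\<^sub>R \<psi>" by (rule sgn_fock_def)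
  show "uniformity = (INF e\<in>{0<..}. principal {(\<psi>, \<phi> :: 'a fock). dist \<psi> \<phi> < e})"
    by (rule uniformity_fock_def)
  show "open U \<longleftrightarrow> (\<forall>\<psi>\<in>U. \<forall>\<^sub>F (\<psi>', \<phi>) in uniformity. \<psi>' = \<psi> \<longrightarrow> \<phi> \<in> U)" for U :: "'a fock set"
    by (rule open_fock_def)
  show "\<psi> \<bullet> \<phi> = \<phi> \<bullet> \<psi>"
    unfolding inner_fock_def braket_def
    by (subst (1 2) infsum_Re[OF braket_summable, symmetric]) (simp add: mult.commute)
  show "(\<psi> + \<phi>) \<bullet> \<xi> = \<psi> \<bullet> \<xi> + \<phi> \<bullet> \<xi>"
    by (simp add: inner_fock_def braket_def amp_simps distrib_right
        infsum_add[OF braket_summable braket_summable])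
  show "r *\<^sub>R \<psi> \<bullet> \<phi> = r * (\<psi> \<bullet> \<phi>)"
    by (simp add: inner_fock_def braket_def amp_simps mult.assoc infsum_cmult_right')
  show "0 \<le> \<psi> \<bullet> \<psi>"
    by (simp add: inner_fock_def Re_braket_self infsum_nonneg)
  show "\<psi> \<bullet> \<psi> = 0 \<longleftrightarrow> \<psi> = 0"
  proof
    assume *: "\<psi> \<bullet> \<psi> = 0"
    show "\<psi> = 0"
    proof (rule fock_eqI)
      fix k
      have "(cmod (amp \<psi> k))\<^sup>2 = 0"
        using * by (intro nonneg_infsum_le_0D[OF _ amp_summable[of \<psi>]])
          (auto simp: inner_fock_def Re_braket_self)
      then show "amp \<psi> k = amp 0 k" by (simp add: amp_simps)
    qed
  qed (simp add: inner_fock_def Re_braket_self amp_simps)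
  show "norm \<psi> = sqrt (\<psi> \<bullet> \<psi>)" by (rule norm_fock_def)
qed

end

definition vacuum :: "('n::finite) fock" where
  "vacuum = Abs_fock (\<lambda>k. if k = (\<lambda>_. 0) then 1 else 0)"

lemma amp_vacuum: "amp vacuum = (\<lambda>k. if k = (\<lambda>_. 0) then 1 else 0)"
  unfolding vacuum_def
proof (rule amp_Abs)
  have "(\<lambda>k. (cmod (if k = (\<lambda>_. 0) then 1 else 0))\<^sup>2) summable_on {\<lambda>_::'a. 0::nat}" by simp
  then show "(\<lambda>k :: 'a \<Rightarrow> nat. (cmod (if k = (\<lambda>_. 0) then 1 else 0))\<^sup>2) summable_on UNIV"
    by (rule summable_on_cong_neutral[THEN iffD1, rotated -1]) auto
qed

definition finite_particle :: "('n::finite) fock \<Rightarrow> bool" where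
  "finite_particle \<psi> \<longleftrightarrow> (\<exists>N. \<forall>k. (\<Sum>i\<in>UNIV. k i) > N \<longrightarrow> amp \<psi> k = 0)"

section \<open>Annihilation and creation operators\<close>

text \<open>
  Since these operators are unbounded, they act on arbitrary amplitude functions;
  the Hamiltonian below is restricted to finite-particle vectors.
\<close>

type_synonym 'n amp_op = "(('n \<Rightarrow> nat) \<Rightarrow> complex) \<Rightarrow> (('n \<Rightarrow> nat) \<Rightarrow> complex)"

text \<open>\<open>a\<^sub>i |k\<rangle> = sqrt (k i) |k - e\<^sub>i\<rangle>\<close> and \<open>a\<^sub>i\<^sup>\<dagger> |k\<rangle> = sqrt (k i + 1) |k + e\<^sub>i\<rangle>\<close>, read off on amplitudes.\<close>

definition annih :: "'n \<Rightarrow> 'n amp_op" where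
  "annih i f = (\<lambda>k. of_real (sqrt (real (k i + 1))) * f (k(i := k i + 1)))"

definition creat :: "'n \<Rightarrow> 'n amp_op" where
  "creat i f = (\<lambda>k. of_real (sqrt (real (k i))) * f (k(i := k i - 1)))"

text \<open>\<open>op_quad X M Y = (X, M Y) = \<Sum>i j. M\<^sub>i\<^sub>j X\<^sub>i Y\<^sub>j\<close> and \<open>op_lin X v = (X, v) = \<Sum>i. v\<^sub>i X\<^sub>i\<close>.\<close>

definition op_quad ::
  "(('n::finite) \<Rightarrow> 'n amp_op) \<Rightarrow> complex^'n^'n \<Rightarrow> ('n \<Rightarrow> 'n amp_op) \<Rightarrow> 'n amp_op" where
  "op_quad X M Y f = (\<lambda>k. \<Sum>i\<in>UNIV. \<Sum>j\<in>UNIV. M $ i $ j * X i (Y j f) k)"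

definition op_lin :: "(('n::finite) \<Rightarrow> 'n amp_op) \<Rightarrow> complex^'n \<Rightarrow> 'n amp_op" where
  "op_lin X v f = (\<lambda>k. \<Sum>i\<in>UNIV. v $ i * X i f k)"

section \<open>The Hamiltonian\<close>

definition cnj_vec :: "complex^('n::finite) \<Rightarrow> complex^'n" where
  "cnj_vec v = (\<chi> i. cnj (v $ i))"

definition cnj_mat :: "complex^('n::finite)^('m::finite) \<Rightarrow> complex^'n^'m" where
  "cnj_mat M = (\<chi> i j. cnj (M $ i $ j))"

definition ham_expr ::
  "complex^'n^'n \<Rightarrow> complex^'n^'n \<Rightarrow> complex^'n \<Rightarrow> ('n::finite) amp_op" where
  "ham_expr A B h f = (\<lambda>k.
     \<i> / 2 * (op_quad creat A creat f k - op_quad annih (cnj_mat A) annih f k)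
     + op_quad creat B annih f k
     + \<i> * op_lin creat h f k - \<i> * op_lin annih (cnj_vec h) f k)"

text \<open>Unbounded operators are represented by their graphs.\<close>

definition ham0 ::
  "complex^'n^'n \<Rightarrow> complex^'n^'n \<Rightarrow> complex^'n \<Rightarrow> (('n::finite) fock \<times> 'n fock) set" where
  "ham0 A B h = {(\<psi>, \<phi>). finite_particle \<psi> \<and> amp \<phi> = ham_expr A B h (amp \<psi>)}"

definition ham ::
  "complex^'n^'n \<Rightarrow> complex^'n^'n \<Rightarrow> complex^'n \<Rightarrow> (('n::finite) fock \<times> 'n fock) set" where
  "ham A B h = closure (ham0 A B h)"

section \<open>One-parameter unitary groups\<close>

definition unitary :: "(('n::finite) fock \<Rightarrow> 'n fock) \<Rightarrow> bool" where
  "unitary V \<longleftrightarrow>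
     (\<forall>\<psi> \<phi>. V (\<psi> + \<phi>) = V \<psi> + V \<phi>) \<and> (\<forall>c \<psi>. V (cscale c \<psi>) = cscale c (V \<psi>)) \<and>
     (\<forall>\<psi> \<phi>. braket (V \<psi>) (V \<phi>) = braket \<psi> \<phi>) \<and> surj V"

definition unitary_group :: "(real \<Rightarrow> ('n::finite) fock \<Rightarrow> 'n fock) \<Rightarrow> bool" where
  "unitary_group U \<longleftrightarrow>
     (\<forall>t. unitary (U t)) \<and> U 0 = id \<and> (\<forall>s t. U (s + t) = U s \<circ> U t) \<and>
     (\<forall>\<psi>. continuous_on UNIV (\<lambda>t. U t \<psi>))"

definition generator ::
  "(real \<Rightarrow> ('n::finite) fock \<Rightarrow> 'n fock) \<Rightarrow> ('n fock \<times> 'n fock) set" where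
  "generator U = {(\<psi>, \<phi>). ((\<lambda>t. (U t \<psi> - \<psi>) /\<^sub>R t) \<longlongrightarrow> \<phi>) (at 0)}"

text \<open>
  \<open>is_exp_i T U\<close> says that \<open>U t = exp (i T t)\<close> for all real \<open>t\<close>: by Stone's theorem, for every
  self-adjoint \<open>T\<close> there is exactly one strongly continuous unitary group whose generator
  (domain included) is \<open>i T\<close>, and conversely such a group exists only if \<open>T\<close> is self-adjoint.
\<close>

definition is_exp_i ::
  "(('n::finite) fock \<times> 'n fock) set \<Rightarrow> (real \<Rightarrow> 'n fock \<Rightarrow> 'n fock) \<Rightarrow> bool" where
  "is_exp_i T U \<longleftrightarrow> unitary_group U \<and> generator U = {(\<psi>, cscale \<i> \<phi>) | \<psi> \<phi>. (\<psi>, \<phi>) \<in> T}"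

section \<open>The classical flow\<close>

definition mat_exp :: "complex^'m^'m \<Rightarrow> complex^('m::finite)^'m" where
  "mat_exp M = (\<Sum>k. (((**) M ^^ k) (mat 1)) /\<^sub>R fact k)"

definition G_mat :: "complex^'n^'n \<Rightarrow> complex^'n^'n \<Rightarrow> complex^('n::finite + 'n)^('n + 'n)" where
  "G_mat A B = (\<chi> p q. case (p, q) of
       (Inl i, Inl j) \<Rightarrow> - \<i> * B $ i $ j
     | (Inl i, Inr j) \<Rightarrow> A $ i $ j
     | (Inr i, Inl j) \<Rightarrow> cnj (A $ i $ j)
     | (Inr i, Inr j) \<Rightarrow> \<i> * cnj (B $ i $ j))"

definition flow ::
  "complex^'n^'n \<Rightarrow> complex^'n^'n \<Rightarrow> real \<Rightarrow> complex^('n::finite + 'n)^('n + 'n)" where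
  "flow A B t = mat_exp (t *\<^sub>R G_mat A B)"

definition Phi :: "complex^'n^'n \<Rightarrow> complex^'n^'n \<Rightarrow> real \<Rightarrow> complex^('n::finite)^'n" where
  "Phi A B t = (\<chi> i j. flow A B t $ Inl i $ Inl j)"

definition Psi :: "complex^'n^'n \<Rightarrow> complex^'n^'n \<Rightarrow> real \<Rightarrow> complex^('n::finite)^'n" where
  "Psi A B t = (\<chi> i j. flow A B t $ Inl i $ Inr j)"

definition doubled :: "complex^('n::finite) \<Rightarrow> complex^('n + 'n)" where
  "doubled h = (\<chi> p. case p of Inl i \<Rightarrow> h $ i | Inr i \<Rightarrow> cnj (h $ i))"

text \<open>
  The upper half of the integral; its lower half is automatically the conjugate vector.
  The library's interval integral is oriented, so negative \<open>t\<close> are covered.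
\<close>

definition h_vec ::
  "complex^'n^'n \<Rightarrow> complex^'n^'n \<Rightarrow> complex^'n \<Rightarrow> real \<Rightarrow> complex^('n::finite)" where
  "h_vec A B h t = (\<chi> i. (LBINT \<tau>=0..t. flow A B \<tau> *v doubled h) $ Inl i)"

definition R_mat :: "complex^'n^'n \<Rightarrow> complex^'n^'n \<Rightarrow> real \<Rightarrow> complex^('n::finite)^'n" where
  "R_mat A B t = matrix_inv (Phi A B t) ** Psi A B t"

definition f_tilde ::
  "complex^'n^'n \<Rightarrow> complex^'n^'n \<Rightarrow> complex^'n \<Rightarrow> real \<Rightarrow> complex^('n::finite)" where
  "f_tilde A B h t = h_vec A B h (- t) + R_mat A B t *v cnj_vec (h_vec A B h (- t))"

end

theory Submission
  imports Defs
begin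

text \<open>
  Let \<open>\<psi>\<^sub>t = U\<^sub>t|0\<rangle>\<close>. The operators \<open>L\<^sub>t = \<Phi>\<^sub>t a + \<Psi>\<^sub>t a\<^sup>\<dagger> + h\<^sub>t\<close> satisfy the Heisenberg equation
  \<open>L' = - i [L, H]\<close>, so the amplitudes of \<open>L\<^sub>t \<psi>\<^sub>t\<close>, which need not form a vector of the Fock space,
  solve the same coordinatewise Schroedinger equation as those of \<open>\<psi>\<^sub>t\<close>, with initial value
  \<open>a|0\<rangle> = 0\<close>. As they grow at most linearly in the particle number, they vanish. Multiplying by
  \<open>\<Phi>\<^sub>t\<^sup>-\<^sup>1\<close> gives \<open>a \<psi>\<^sub>t = f \<psi>\<^sub>t - R a\<^sup>\<dagger> \<psi>\<^sub>t\<close> with \<open>f = - \<Phi>\<^sub>t\<^sup>-\<^sup>1 h\<^sub>t\<close>, which is the vector \<open>f_tilde\<close>.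
  Reading this off at the vacuum turns \<open>d/dt \<langle>0|\<psi>\<^sub>t\<rangle> = \<langle>0|iH \<psi>\<^sub>t\<rangle>\<close> into a scalar linear equation whose
  coefficient is the integrand.
\<close>

section \<open>The classical flow\<close>

text \<open>Unitarity alone does not put \<open>U t vacuum\<close> into the domain of an
  annihilation operator, so the argument is carried out on amplitude functions, where annihilation
  and creation act without domain restrictions. The closed operator enters only through number
  states, which lie in its domain; testing against them gives a differential equation for every
  amplitude. The price is that the vanishing of L_t psi_t cannot be read off from the unitary group:
  it needs a uniqueness theorem for an infinite system with unbounded coefficients. What saves
  uniqueness is that the system couples only total particle numbers at distance at most two, with
  coefficients linear in that number.

  The natural form of f is - Phi_t^(-1) h_t. It agrees with \<open>f_tilde\<close>, which is built
  from h at time - t, because e^(G t) carries the integral over [0, - t] to the one over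
  [t, 0].\<close>

lemma cmod_matrix_power_le:
  fixes M :: "complex^'m^('m::finite)"
  shows "cmod ((((**) M ^^ k) (mat 1)) $ p $ q) \<le> (\<Sum>i\<in>UNIV. \<Sum>j\<in>UNIV. cmod (M $ i $ j)) ^ k"
proof (induction k arbitrary: p q)
  case 0
  then show ?case by (simp add: mat_def)
next
  case (Suc k)
  let ?C = "\<Sum>i\<in>UNIV. \<Sum>j\<in>UNIV. cmod (M $ i $ j)"
  let ?N = "((**) M ^^ k) (mat 1)"
  have "cmod ((M ** ?N) $ p $ q) \<le> (\<Sum>r\<in>UNIV. cmod (M $ p $ r) * ?C ^ k)"
    unfolding matrix_matrix_mult_def[of M ?N]
    by (simp, intro sum_norm_le) (simp add: norm_mult mult_left_mono Suc)
  also have "\<dots> = (\<Sum>r\<in>UNIV. cmod (M $ p $ r)) * ?C ^ k"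
    by (simp add: sum_distrib_right)
  also have "\<dots> \<le> ?C * ?C ^ k"
    by (intro mult_right_mono member_le_sum) (auto intro!: sum_nonneg zero_le_power)
  finally show ?case by simp
qed

lemma matrix_power_Suc_right:
  "((**) M ^^ Suc k) (mat 1) = ((**) M ^^ k) (mat 1) ** (M :: 'a::semiring_1^'m^('m::finite))"
  by (induction k) (simp_all add: matrix_mul_assoc)

lemma matrix_power_scaleR:
  fixes M :: "complex^'m^('m::finite)"
  shows "((**) (t *\<^sub>R M) ^^ k) (mat 1) = t ^ k *\<^sub>R ((**) M ^^ k) (mat 1)"
  by (induction k)
    (simp_all add: matrix_matrix_mult_def vec_eq_iff scaleR_sum_right mult_ac)

lemma summable_matrix_power_series:
  fixes M :: "complex^'m^('m::finite)"
  shows "summable (\<lambda>k. ((((**) M ^^ k) (mat 1)) $ p $ q / fact k) * z ^ k)"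
proof (rule summable_comparison_test[OF _ summable_exp])
  let ?C = "\<Sum>i\<in>UNIV. \<Sum>j\<in>UNIV. cmod (M $ i $ j)"
  show "\<exists>N. \<forall>n\<ge>N. norm ((((**) M ^^ n) (mat 1)) $ p $ q / fact n * z ^ n)
      \<le> inverse (fact n) * (?C * cmod z) ^ n"
  proof (intro exI allI impI)
    fix n
    show "norm ((((**) M ^^ n) (mat 1)) $ p $ q / fact n * z ^ n)
      \<le> inverse (fact n) * (?C * cmod z) ^ n"
      using mult_right_mono[OF cmod_matrix_power_le[of n M p q], of "cmod z ^ n / fact n"]
      by (simp add: norm_mult norm_divide norm_power power_mult_distrib field_simps)
  qed
qed

text \<open>Read entry by entry, the exponential is a scalar power series in t with infinite radius
  of convergence, so that termwise differentiation of scalar series applies.\<close>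

lemma mat_exp_scaleR_nth:
  fixes M :: "complex^'m^('m::finite)"
  shows "mat_exp (t *\<^sub>R M) $ p $ q =
    (\<Sum>k. ((((**) M ^^ k) (mat 1)) $ p $ q / fact k) * of_real t ^ k)"
proof -
  let ?S = "\<chi> p q. \<Sum>k. ((((**) M ^^ k) (mat 1)) $ p $ q / fact k) * of_real t ^ k"
  have "(\<lambda>k. (((**) (t *\<^sub>R M) ^^ k) (mat 1)) /\<^sub>R fact k) sums ?S"
    unfolding sums_def
  proof (intro vec_tendstoI)
    fix i j
    have "(\<lambda>k. ((((**) M ^^ k) (mat 1)) $ i $ j / fact k) * of_real t ^ k) sums (?S $ i $ j)"
      using summable_matrix_power_series[of M i j "of_real t"] by (simp add: summable_sums)
    then show "(\<lambda>n. (\<Sum>k<n. (((**) (t *\<^sub>R M) ^^ k) (mat 1)) /\<^sub>R fact k) $ i $ j)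
        \<longlonglongrightarrow> ?S $ i $ j"
      unfolding sums_def
      by (simp add: matrix_power_scaleR scaleR_conv_of_real[where 'a=complex] field_simps)
  qed
  then show ?thesis unfolding mat_exp_def by (simp add: sums_iff)
qed

lemma mat_exp_zero: "mat_exp (0 *\<^sub>R M) = (mat 1 :: complex^'m^('m::finite))"
proof -
  have "mat_exp (0 *\<^sub>R M) $ p $ q = mat 1 $ p $ q" for p q
    unfolding mat_exp_scaleR_nth
    by (subst suminf_finite[of "{0}"]) (auto simp: power_0_left)
  then show ?thesis by (simp add: vec_eq_iff)
qed

text \<open>In the differentiated series one factor \<open>M\<close> splits off on either side of a
  power. The right form drives the rows of the flow, which serve as coefficients of field operators;
  the left form is needed for \<open>G_mat\<close> acting on the integrated flow.\<close>

lemma mat_exp_has_vector_derivative: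
  fixes M :: "complex^'m^('m::finite)"
  shows mat_exp_has_vector_derivative_left:
      "((\<lambda>t. mat_exp (t *\<^sub>R M) $ p $ q) has_vector_derivative (M ** mat_exp (t *\<^sub>R M)) $ p $ q) (at t within X)"
    and mat_exp_has_vector_derivative_right:
      "((\<lambda>t. mat_exp (t *\<^sub>R M) $ p $ q) has_vector_derivative (mat_exp (t *\<^sub>R M) ** M) $ p $ q) (at t within X)"
proof -
  let ?c = "\<lambda>p q k. (((**) M ^^ k) (mat 1)) $ p $ q / fact k"
  let ?D = "\<Sum>k. diffs (?c p q) k * of_real t ^ k"
  have D: "((\<lambda>t. mat_exp (t *\<^sub>R M) $ p $ q) has_vector_derivative ?D) (at t within X)"
    unfolding mat_exp_scaleR_nth
    by (intro has_vector_derivative_real_field termdiffs_strong_converges_everywhere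
        summable_matrix_power_series)
  have diffs: "diffs (?c p q) k = (((**) M ^^ Suc k) (mat 1)) $ p $ q / fact k" for k
    unfolding diffs_def by (simp add: field_simps del: funpow.simps of_nat_Suc)
  have "?D = (\<Sum>k. \<Sum>r\<in>UNIV. M $ p $ r * (?c r q k * of_real t ^ k))"
    unfolding diffs by (simp add: matrix_matrix_mult_def sum_divide_distrib sum_distrib_right mult.assoc)
  also have "\<dots> = (\<Sum>r\<in>UNIV. M $ p $ r * (\<Sum>k. ?c r q k * of_real t ^ k))"
    by (subst suminf_sum) (intro summable_mult summable_matrix_power_series sum.cong refl suminf_mult)+
  finally have "?D = (M ** mat_exp (t *\<^sub>R M)) $ p $ q"
    unfolding mat_exp_scaleR_nth[symmetric] by (simp add: matrix_matrix_mult_def)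
  with D show "((\<lambda>t. mat_exp (t *\<^sub>R M) $ p $ q) has_vector_derivative (M ** mat_exp (t *\<^sub>R M)) $ p $ q) (at t within X)"
    by simp
  have "?D = (\<Sum>k. \<Sum>r\<in>UNIV. M $ r $ q * (?c p r k * of_real t ^ k))"
    unfolding diffs matrix_power_Suc_right
    by (simp add: matrix_matrix_mult_def sum_divide_distrib sum_distrib_left mult_ac)
  also have "\<dots> = (\<Sum>r\<in>UNIV. M $ r $ q * (\<Sum>k. ?c p r k * of_real t ^ k))"
    by (subst suminf_sum) (intro summable_mult summable_matrix_power_series sum.cong refl suminf_mult)+
  finally have "?D = (mat_exp (t *\<^sub>R M) ** M) $ p $ q"
    unfolding mat_exp_scaleR_nth[symmetric] by (simp add: matrix_matrix_mult_def mult.commute)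
  with D show "((\<lambda>t. mat_exp (t *\<^sub>R M) $ p $ q) has_vector_derivative (mat_exp (t *\<^sub>R M) ** M) $ p $ q) (at t within X)"
    by simp
qed

text \<open>The conservation law and the identities in t below share one pattern: a suitable
  expression has derivative zero, so it keeps its value at t = 0, which is computed
  directly.\<close>

lemma has_vector_derivative_zero_imp_eq:
  fixes f :: "real \<Rightarrow> 'a::real_normed_vector"
  assumes "\<And>t. (f has_vector_derivative 0) (at t)"
  shows "f s = f t"
proof -
  obtain c where "\<And>x. x \<in> UNIV \<Longrightarrow> f x = c"
    by (rule has_vector_derivative_zero_constant[of UNIV f]) (use assms in auto)
  then show ?thesis by simp
qed

lemma interval_integral_has_vector_derivative:
  fixes f :: "real \<Rightarrow> 'a::euclidean_space"
  assumes "continuous_on UNIV f"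
  shows "((\<lambda>t. LBINT \<tau>=0..ereal t. f \<tau>) has_vector_derivative f t) (at t)"
proof -
  \<comment> \<open>The window [-b, b] has both 0 and t in its interior, so the one-sided theorem
    yields a two-sided derivative, for negative t as well.\<close>
  define b where "b = \<bar>t\<bar> + 1"
  have "((\<lambda>u. LBINT y=ereal 0..ereal u. f y) has_vector_derivative f t) (at t within {-b..b})"
    by (rule interval_integral_FTC2) (auto simp: b_def intro: continuous_on_subset[OF assms])
  then have "((\<lambda>u. LBINT y=ereal 0..ereal u. f y) has_vector_derivative f t) (at t within {-b<..<b})"
    by (rule has_vector_derivative_within_subset) auto
  then show ?thesis
    by (subst (asm) at_within_open) (auto simp: b_def zero_ereal_def)
qed

text \<open>Combined with complex conjugation, this exchange of the two halves is the real structure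
  preserved by \<open>G_mat\<close>. It is why the lower blocks of the flow and the lower half of
  the integrated vector are conjugates of the upper ones.\<close>

definition swap_sum :: "'a + 'a \<Rightarrow> 'a + 'a" where
  "swap_sum = case_sum Inr Inl"

lemma swap_sum_simps [simp]:
  "swap_sum (Inl i) = Inr i" "swap_sum (Inr i) = Inl i" "swap_sum (swap_sum p) = p"
  by (simp_all add: swap_sum_def split: sum.splits)

lemma sum_swap_sum: "(\<Sum>p\<in>UNIV. f (swap_sum p)) = (\<Sum>p\<in>UNIV. f p)"
  by (rule sum.reindex_bij_witness[of _ swap_sum swap_sum]) auto

lemma sum_UNIV_Plus:
  fixes f :: "('a::finite + 'b::finite) \<Rightarrow> 'c::comm_monoid_add"
  shows "(\<Sum>p\<in>UNIV. f p) = (\<Sum>i\<in>UNIV. f (Inl i)) + (\<Sum>j\<in>UNIV. f (Inr j))"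
  by (simp add: sum.Plus flip: UNIV_Plus_UNIV)

lemma G_mat_swap: "G_mat A B $ swap_sum p $ swap_sum q = cnj (G_mat A B $ p $ q)"
  by (cases p; cases q) (simp_all add: G_mat_def)

lemma G_mat_power_swap:
  "((**) (G_mat A B) ^^ k) (mat 1) $ swap_sum p $ swap_sum q
    = cnj (((**) (G_mat A B) ^^ k) (mat 1) $ p $ q)"
proof (induction k arbitrary: p)
  case 0
  then show ?case by (cases p; cases q) (simp_all add: mat_def)
next
  case (Suc k)
  let ?N = "((**) (G_mat A B) ^^ k) (mat 1)"
  have "(\<Sum>r\<in>UNIV. G_mat A B $ swap_sum p $ swap_sum r * ?N $ swap_sum r $ swap_sum q)
      = (\<Sum>r\<in>UNIV. G_mat A B $ swap_sum p $ r * ?N $ r $ swap_sum q)"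
    by (rule sum_swap_sum)
  then show ?case
    using Suc by (simp add: matrix_matrix_mult_def[of "G_mat A B" ?N] G_mat_swap)
qed

lemma flow_swap: "flow A B t $ swap_sum p $ swap_sum q = cnj (flow A B t $ p $ q)"
proof -
  let ?c = "\<lambda>k. (((**) (G_mat A B) ^^ k) (mat 1)) $ p $ q / fact k * of_real t ^ k"
  have "cnj (\<Sum>k. ?c k) = (\<Sum>k. cnj (?c k))"
    by (rule bounded_linear.suminf[OF bounded_linear_cnj summable_matrix_power_series])
  then show ?thesis
    unfolding flow_def mat_exp_scaleR_nth by (simp add: G_mat_power_swap)
qed

section \<open>Derivatives of the flow and invertibility of its upper left block\<close>

lemma flow_zero: "flow A B 0 = mat 1"
  unfolding flow_def by (rule mat_exp_zero)

lemma
  shows flow_derivative_left: "((\<lambda>t. flow A B t $ p $ q) has_vector_derivative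
      (\<Sum>r\<in>UNIV. G_mat A B $ p $ r * flow A B t $ r $ q)) (at t within X)"
    and flow_derivative_right: "((\<lambda>t. flow A B t $ p $ q) has_vector_derivative
      (\<Sum>r\<in>UNIV. flow A B t $ p $ r * G_mat A B $ r $ q)) (at t within X)"
  using mat_exp_has_vector_derivative[where M = "G_mat A B" and p = p and q = q and t = t and X = X]
  unfolding flow_def by (simp_all add: matrix_matrix_mult_def)

lemma continuous_on_flow [continuous_intros]: "continuous_on X (\<lambda>t. flow A B t $ p $ q)"
  by (rule continuous_on_vector_derivative) (rule flow_derivative_left)

text \<open>With E the diagonal matrix of the signs \<open>\<epsilon>\<close>, this is G E + E G^* =
  0, so G lies in the Lie algebra of U(n,n). The off-diagonal blocks use the symmetry of
  \<open>A\<close>, the diagonal ones the Hermiticity of \<open>B\<close>.\<close>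

lemma G_mat_symplectic:
  assumes "A = transpose A" "B = cnj_mat (transpose B)"
  defines "\<epsilon> \<equiv> \<lambda>p. case p of Inl _ \<Rightarrow> 1 | Inr _ \<Rightarrow> - 1"
  shows "\<epsilon> q * G_mat A B $ p $ q + \<epsilon> p * cnj (G_mat A B $ q $ p) = 0"
proof -
  have "A $ i $ j = A $ j $ i" "cnj (B $ i $ j) = B $ j $ i" for i j
    using arg_cong[OF assms(1), of "\<lambda>M. M $ i $ j"] arg_cong[OF assms(2), of "\<lambda>M. M $ j $ i"]
    by (simp_all add: transpose_def cnj_mat_def)
  then show ?thesis
    by (cases p; cases q) (simp_all add: G_mat_def \<epsilon>_def)
qed

text \<open>
  A row \<open>(p, q)\<close> evolving by \<open>(p, q)' = (p, q) G\<close> conserves \<open>|p|\<^sup>2 - |q|\<^sup>2\<close>, so that \<open>u \<Phi>\<^sub>t\<close> is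
  at least as long as \<open>u\<close>.
\<close>

lemma det_Phi_nonzero:
  assumes "A = transpose A" "B = cnj_mat (transpose B)"
  shows "det (Phi A B t) \<noteq> 0"
proof -
  let ?P = "transpose (Phi A B t)"
  define \<epsilon> :: "'a + 'a \<Rightarrow> complex" where "\<epsilon> = (\<lambda>p. case p of Inl _ \<Rightarrow> 1 | Inr _ \<Rightarrow> - 1)"
  have sym: "\<epsilon> q * G_mat A B $ p $ q + \<epsilon> p * cnj (G_mat A B $ q $ p) = 0" for p q
    unfolding \<epsilon>_def by (rule G_mat_symplectic[OF assms])
  have "u = 0" if u: "?P *v u = 0" for u
  proof -
    define r where "r = (\<lambda>t p. \<Sum>i\<in>UNIV. u $ i * flow A B t $ Inl i $ p)"
    have r': "((\<lambda>t. r t p) has_vector_derivative (\<Sum>q\<in>UNIV. r t q * G_mat A B $ q $ p)) (at t)" for t p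
    proof -
      have "((\<lambda>t. r t p) has_vector_derivative
          (\<Sum>i\<in>UNIV. u $ i * (\<Sum>q\<in>UNIV. flow A B t $ Inl i $ q * G_mat A B $ q $ p))) (at t)"
        unfolding r_def
        by (intro has_vector_derivative_sum has_vector_derivative_mult_right flow_derivative_right)
      then show ?thesis
        by (simp add: r_def sum_distrib_left sum_distrib_right mult.assoc) (subst sum.swap, simp)
    qed
    define K where "K = (\<lambda>t. \<Sum>p\<in>UNIV. \<epsilon> p * (r t p * cnj (r t p)))"
    have "(K has_vector_derivative 0) (at t)" for t
    proof -
      have "(K has_vector_derivative (\<Sum>p\<in>UNIV. \<epsilon> p *
          (r t p * cnj (\<Sum>q\<in>UNIV. r t q * G_mat A B $ q $ p)
            + (\<Sum>q\<in>UNIV. r t q * G_mat A B $ q $ p) * cnj (r t p)))) (at t)"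
        unfolding K_def
        by (intro has_vector_derivative_sum has_vector_derivative_mult_right has_vector_derivative_mult
            has_vector_derivative_cnj r')
      also have "(\<Sum>p\<in>UNIV. \<epsilon> p *
          (r t p * cnj (\<Sum>q\<in>UNIV. r t q * G_mat A B $ q $ p)
            + (\<Sum>q\<in>UNIV. r t q * G_mat A B $ q $ p) * cnj (r t p)))
        = (\<Sum>p\<in>UNIV. \<Sum>q\<in>UNIV. \<epsilon> p * r t p * cnj (r t q) * cnj (G_mat A B $ q $ p))
          + (\<Sum>p\<in>UNIV. \<Sum>q\<in>UNIV. \<epsilon> p * r t q * cnj (r t p) * G_mat A B $ q $ p)"
        by (simp add: sum_distrib_left sum_distrib_right sum.distrib algebra_simps)
      also have "(\<Sum>p\<in>UNIV. \<Sum>q\<in>UNIV. \<epsilon> p * r t q * cnj (r t p) * G_mat A B $ q $ p)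
        = (\<Sum>p\<in>UNIV. \<Sum>q\<in>UNIV. \<epsilon> q * r t p * cnj (r t q) * G_mat A B $ p $ q)"
        by (rule sum.swap)
      also have "(\<Sum>p\<in>UNIV. \<Sum>q\<in>UNIV. \<epsilon> p * r t p * cnj (r t q) * cnj (G_mat A B $ q $ p)) + \<dots>
        = (\<Sum>p\<in>UNIV. \<Sum>q\<in>UNIV. r t p * cnj (r t q) *
            (\<epsilon> q * G_mat A B $ p $ q + \<epsilon> p * cnj (G_mat A B $ q $ p)))"
        by (simp add: algebra_simps flip: sum.distrib)
      also have "\<dots> = 0" by (simp only: sym) simp
      finally show ?thesis .
    qed
    then have "K 0 = K t" by (rule has_vector_derivative_zero_imp_eq)
    moreover have r0: "r t (Inl j) = 0" for j
      using arg_cong[OF u, of "\<lambda>v. v $ j"]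
      by (simp add: r_def matrix_vector_mult_def transpose_def Phi_def mult.commute)
    moreover have "r 0 p = (case p of Inl i \<Rightarrow> u $ i | Inr _ \<Rightarrow> 0)" for p
      by (auto simp: r_def flow_zero mat_def if_distrib[of "\<lambda>x. _ * x"] cong: if_cong split: sum.splits)
    \<comment> \<open>At time 0 the row is (u, 0); at time t its left half u Phi_t is zero by
      assumption. Conservation thus equates |u|^2 with minus the squared length of the right
      half.\<close>
    ultimately have "(\<Sum>i\<in>UNIV. of_real ((cmod (u $ i))\<^sup>2)) + (\<Sum>i\<in>UNIV. of_real ((cmod (r t (Inr i)))\<^sup>2)) = (0::complex)"
      by (simp add: K_def sum_UNIV_Plus \<epsilon>_def complex_norm_square sum_negf del: of_real_power)
    then have "(\<Sum>i\<in>UNIV. (cmod (u $ i))\<^sup>2) + (\<Sum>i\<in>UNIV. (cmod (r t (Inr i)))\<^sup>2) = 0"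
      by (simp only: of_real_sum[symmetric] of_real_add[symmetric] of_real_eq_0_iff)
    then have "(\<Sum>i\<in>UNIV. (cmod (u $ i))\<^sup>2) = 0"
      by (metis add_nonneg_eq_0_iff sum_nonneg zero_le_power2)
    then show "u = 0" by (simp add: sum_nonneg_eq_0_iff vec_eq_iff)
  qed
  then have "\<exists>Q. Q ** ?P = mat 1" by (simp add: matrix_left_invertible_ker)
  then have "det ?P \<noteq> 0" unfolding invertible_left_inverse[symmetric] invertible_det_nz .
  then show ?thesis by simp
qed

text \<open>Both halves are kept because only the doubled vector obeys linear identities with the
  flow; \<open>h_vec\<close> is its upper half and the conjugate of \<open>h_vec\<close> its lower
  half.\<close>

definition flow_integral ::
  "complex^'n^'n \<Rightarrow> complex^'n^'n \<Rightarrow> complex^'n \<Rightarrow> real \<Rightarrow> complex^(('n::finite) + 'n)" where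
  "flow_integral A B h t = (LBINT \<tau>=0..ereal t. flow A B \<tau> *v doubled h)"

lemma flow_integral_zero: "flow_integral A B h 0 = 0"
  by (simp add: flow_integral_def flip: zero_ereal_def)

lemma flow_integral_derivative:
  "((\<lambda>t. flow_integral A B h t $ p) has_vector_derivative
    (\<Sum>q\<in>UNIV. flow A B t $ p $ q * doubled h $ q)) (at t)"
proof -
  have "continuous_on UNIV (\<lambda>\<tau>. flow A B \<tau> *v doubled h)"
    unfolding matrix_vector_mult_def by (intro continuous_intros)
  then have "(flow_integral A B h has_vector_derivative flow A B t *v doubled h) (at t)"
    unfolding flow_integral_def by (rule interval_integral_has_vector_derivative)
  from bounded_linear.has_vector_derivative[OF bounded_linear_vec_nth this, of p]
  show ?thesis by (simp add: matrix_vector_mult_def)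
qed

lemma flow_integral_derivative_minus:
  "((\<lambda>t. flow_integral A B h (- t) $ p) has_vector_derivative
    - (\<Sum>q\<in>UNIV. flow A B (- t) $ p $ q * doubled h $ q)) (at t)"
  using vector_diff_chain_at[of uminus "-1" t "\<lambda>t. flow_integral A B h t $ p", OF _ flow_integral_derivative]
  by (simp add: o_def has_vector_derivative_minus has_vector_derivative_id)

lemma flow_integral_swap: "flow_integral A B h t $ swap_sum p = cnj (flow_integral A B h t $ p)"
proof -
  have swap: "(\<Sum>q\<in>UNIV. flow A B t $ swap_sum p $ q * doubled h $ q)
      = cnj (\<Sum>q\<in>UNIV. flow A B t $ p $ q * doubled h $ q)" for t
  proof -
    have "doubled h $ swap_sum q = cnj (doubled h $ q)" for q
      by (cases q) (simp_all add: doubled_def)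
    then have "cnj (\<Sum>q\<in>UNIV. flow A B t $ p $ q * doubled h $ q)
        = (\<Sum>q\<in>UNIV. flow A B t $ swap_sum p $ swap_sum q * doubled h $ swap_sum q)"
      by (simp add: flow_swap)
    then show ?thesis
      by (simp add: sum_swap_sum[of "\<lambda>q. flow A B t $ swap_sum p $ q * doubled h $ q"])
  qed
  have "((\<lambda>t. flow_integral A B h t $ swap_sum p - cnj (flow_integral A B h t $ p))
      has_vector_derivative 0) (at t)" for t
    using has_vector_derivative_diff[OF flow_integral_derivative[of A B h "swap_sum p" t]
        has_vector_derivative_cnj[OF flow_integral_derivative[of A B h p t]]]
    by (simp add: swap)
  from has_vector_derivative_zero_imp_eq[OF this, of t 0]
  show ?thesis by (simp add: flow_integral_zero)
qed

lemma G_mat_flow_integral: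
  "(\<Sum>q\<in>UNIV. G_mat A B $ p $ q * flow_integral A B h t $ q)
    = (\<Sum>q\<in>UNIV. flow A B t $ p $ q * doubled h $ q) - doubled h $ p"
proof -
  have "((\<lambda>t. (\<Sum>q\<in>UNIV. G_mat A B $ p $ q * flow_integral A B h t $ q)
      - (\<Sum>q\<in>UNIV. flow A B t $ p $ q * doubled h $ q)) has_vector_derivative
      (\<Sum>q\<in>UNIV. G_mat A B $ p $ q * (\<Sum>r\<in>UNIV. flow A B t $ q $ r * doubled h $ r))
      - (\<Sum>q\<in>UNIV. (\<Sum>r\<in>UNIV. G_mat A B $ p $ r * flow A B t $ r $ q) * doubled h $ q)) (at t)" for t
    by (intro has_vector_derivative_diff has_vector_derivative_sum has_vector_derivative_mult_right
        has_vector_derivative_mult_left flow_integral_derivative flow_derivative_left)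
  moreover have "(\<Sum>q\<in>UNIV. G_mat A B $ p $ q * (\<Sum>r\<in>UNIV. flow A B t $ q $ r * doubled h $ r))
      = (\<Sum>q\<in>UNIV. (\<Sum>r\<in>UNIV. G_mat A B $ p $ r * flow A B t $ r $ q) * doubled h $ q)" for t
    by (simp add: sum_distrib_left sum_distrib_right mult.assoc) (rule sum.swap)
  ultimately have "((\<lambda>t. (\<Sum>q\<in>UNIV. G_mat A B $ p $ q * flow_integral A B h t $ q)
      - (\<Sum>q\<in>UNIV. flow A B t $ p $ q * doubled h $ q)) has_vector_derivative 0) (at t)" for t
    by simp
  from has_vector_derivative_zero_imp_eq[OF this, of t 0]
  show ?thesis
    by (simp add: flow_integral_zero flow_zero mat_def algebra_simps if_distrib[of "\<lambda>x. _ * x"]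
        if_distrib[of "\<lambda>x. x * _"] cong: if_cong)
qed

text \<open>Multiplying by e^(G t) shifts the integration interval from [0, - t] to [t, 0]. In the
  proof the terms of the derivative cancel by \<open>G_mat_flow_integral\<close> at - t. The upper
  half, Phi_t h_(-t) + Psi_t conj(h_(-t)) = - h_t, explains the form of
  \<open>f_tilde\<close>.\<close>

lemma flow_flow_integral_minus:
  "(\<Sum>q\<in>UNIV. flow A B t $ p $ q * flow_integral A B h (- t) $ q) = - flow_integral A B h t $ p"
proof -
  have "((\<lambda>t. (\<Sum>q\<in>UNIV. flow A B t $ p $ q * flow_integral A B h (- t) $ q)
      + flow_integral A B h t $ p) has_vector_derivative 0) (at t)" for t
  proof -
    let ?E = "\<lambda>q. \<Sum>r\<in>UNIV. flow A B (- t) $ q $ r * doubled h $ r"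
    have "((\<lambda>t. (\<Sum>q\<in>UNIV. flow A B t $ p $ q * flow_integral A B h (- t) $ q)
        + flow_integral A B h t $ p) has_vector_derivative
      (\<Sum>q\<in>UNIV. flow A B t $ p $ q * (- ?E q)
        + (\<Sum>r\<in>UNIV. flow A B t $ p $ r * G_mat A B $ r $ q) * flow_integral A B h (- t) $ q)
      + (\<Sum>q\<in>UNIV. flow A B t $ p $ q * doubled h $ q)) (at t)"
      by (intro has_vector_derivative_add has_vector_derivative_sum has_vector_derivative_mult
          flow_integral_derivative flow_integral_derivative_minus flow_derivative_right)
    moreover have "(\<Sum>q\<in>UNIV. (\<Sum>r\<in>UNIV. flow A B t $ p $ r * G_mat A B $ r $ q) * flow_integral A B h (- t) $ q)
        = (\<Sum>r\<in>UNIV. flow A B t $ p $ r * (\<Sum>q\<in>UNIV. G_mat A B $ r $ q * flow_integral A B h (- t) $ q))"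
      by (simp add: sum_distrib_left sum_distrib_right mult.assoc) (rule sum.swap)
    ultimately show ?thesis
      by (simp add: G_mat_flow_integral sum.distrib right_diff_distrib sum_subtractf sum_negf)
  qed
  from has_vector_derivative_zero_imp_eq[OF this, of t 0]
  show ?thesis by (simp add: flow_integral_zero add_eq_0_iff)
qed

section \<open>The linear relations and the continuity of \<open>R_mat\<close> and
  \<open>f_tilde\<close>\<close>

lemma h_vec_nth: "h_vec A B h t $ i = flow_integral A B h t $ Inl i"
  by (simp add: h_vec_def flow_integral_def)

lemma cnj_h_vec_nth: "cnj (h_vec A B h t $ i) = flow_integral A B h t $ Inr i"
  using flow_integral_swap[of A B h t "Inl i"] by (simp add: h_vec_nth)

lemma matrix_inv_mult:
  fixes M :: "'a::field^'n^('n::finite)"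
  assumes "det M \<noteq> 0"
  shows "M ** (matrix_inv M ** N) = N"
proof -
  have "invertible M" using assms by (simp add: invertible_det_nz)
  then have "M ** matrix_inv M = mat 1"
    unfolding invertible_def matrix_inv_def by (rule someI2_ex) blast
  then show ?thesis by (simp add: matrix_mul_assoc)
qed

lemma Phi_R_mat:
  assumes "det (Phi A B t) \<noteq> 0"
  shows "Phi A B t ** R_mat A B t = Psi A B t"
  unfolding R_mat_def by (rule matrix_inv_mult[OF assms])

lemma Phi_f_tilde:
  assumes "det (Phi A B t) \<noteq> 0"
  shows "Phi A B t *v f_tilde A B h t = - h_vec A B h t"
proof -
  have "Phi A B t *v f_tilde A B h t
      = Phi A B t *v h_vec A B h (- t) + Psi A B t *v cnj_vec (h_vec A B h (- t))"
    unfolding f_tilde_def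
    by (simp add: matrix_vector_right_distrib matrix_vector_mul_assoc Phi_R_mat[OF assms])
  also have "\<dots> = - h_vec A B h t"
    using flow_flow_integral_minus[of A B t "Inl _" h]
    by (simp add: vec_eq_iff matrix_vector_mult_def Phi_def Psi_def cnj_vec_def h_vec_nth
        cnj_h_vec_nth[unfolded h_vec_nth] sum_UNIV_Plus)
  finally show ?thesis .
qed

lemma continuous_on_h_vec [continuous_intros]: "continuous_on X (\<lambda>t. h_vec A B h t $ i)"
  unfolding h_vec_nth
  by (rule continuous_on_vector_derivative)
    (rule has_vector_derivative_at_within, rule flow_integral_derivative)

lemma continuous_on_det:
  fixes M :: "'a::topological_space \<Rightarrow> 'b::real_normed_field^'n^('n::finite)"
  assumes "\<And>i j. continuous_on X (\<lambda>t. M t $ i $ j)"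
  shows "continuous_on X (\<lambda>t. det (M t))"
  unfolding det_def by (intro continuous_intros assms)

text \<open>Cramer's rule writes each entry as a quotient of determinants in entries of the flow, so
  continuity needs only a nonzero denominator.\<close>

lemma continuous_on_R_mat:
  assumes "\<And>t. det (Phi A B t) \<noteq> 0"
  shows "continuous_on X (\<lambda>t. R_mat A B t $ i $ j)"
proof -
  have cramer: "R_mat A B t $ i $ j
      = det (\<chi> k l. if l = i then Psi A B t $ k $ j else Phi A B t $ k $ l) / det (Phi A B t)" for t
  proof -
    have "Phi A B t *v column j (R_mat A B t) = column j (Psi A B t)"
      using Phi_R_mat[OF assms, of t]
      by (simp add: vec_eq_iff column_def matrix_vector_mult_def matrix_matrix_mult_def)
    then have "column j (R_mat A B t) = (\<chi> i. det (\<chi> k l. if l = i then column j (Psi A B t) $ k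
        else Phi A B t $ k $ l) / det (Phi A B t))"
      by (simp add: cramer[OF assms])
    from arg_cong[OF this, of "\<lambda>v. v $ i"] show ?thesis by (simp add: column_def cong: if_cong)
  qed
  have "continuous_on X (\<lambda>t. if l = i then Psi A B t $ k $ j else Phi A B t $ k $ l)" for k l
    by (cases "l = i") (auto simp: Psi_def Phi_def intro: continuous_intros)
  then show ?thesis
    unfolding cramer using assms
    by (intro continuous_on_divide continuous_on_det) (simp_all add: Phi_def continuous_on_flow)
qed

lemma continuous_on_f_tilde:
  assumes "\<And>t. det (Phi A B t) \<noteq> 0"
  shows "continuous_on X (\<lambda>t. f_tilde A B h t $ i)"
proof -
  have "continuous_on X (\<lambda>t. h_vec A B h (- t) $ i)" for i
    by (rule continuous_on_compose2[OF continuous_on_h_vec[of UNIV]]) (auto intro: continuous_intros)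
  then show ?thesis
    unfolding f_tilde_def matrix_vector_mult_def cnj_vec_def vector_add_component vec_lambda_beta
    by (intro continuous_on_add continuous_on_sum continuous_on_mult continuous_on_cnj
        continuous_on_R_mat assms)
qed

section \<open>Uniqueness for banded linear systems\<close>

lemma prod_arith_progression_Suc:
  "(\<Prod>j<Suc r. real (m + 2 + 2 * j)) = real (m + 2) * (\<Prod>j<r. real (m + 2 + 2 + 2 * j))"
  by (subst prod.lessThan_Suc_shift) (simp add: algebra_simps)

text \<open>Each factor m + 2 + 2j is at most 2(m + 1 + j), which leaves 2^r r! times the binomial
  coefficient of m + r over r, itself at most 2^(m + r). The starting size m only affects the
  prefactor 2^m, not the rate 4^r.\<close>

lemma prod_arith_progression_le: "(\<Prod>j<r. real (m + 2 + 2 * j)) \<le> 4 ^ r * 2 ^ m * fact r"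
proof -
  have fact_mult: "fact m * (\<Prod>j<r. real (m + 1 + j)) = fact (m + r)"
    by (induction r) (simp_all add: mult.assoc[symmetric] mult.commute[of "fact _" "1 + _"] add_ac)
  have "fact m * (\<Prod>j<r. real (m + 2 + 2 * j)) \<le> fact m * (\<Prod>j<r. 2 * real (m + 1 + j))"
    by (intro mult_left_mono prod_mono) auto
  also have "\<dots> = 2 ^ r * fact (m + r)"
    by (simp only: prod.distrib fact_mult[symmetric]) simp
  also have "fact (m + r) = real ((m + r) choose r) * (fact m * fact r)"
    using arg_cong[OF binomial_fact_lemma[of r "m + r"], of real] by (simp add: mult_ac)
  also have "\<dots> \<le> 2 ^ (m + r) * (fact m * fact r)"
    using binomial_le_pow2[of "m + r" r, THEN of_nat_mono, where 'a=real]
    by (intro mult_right_mono) simp_all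
  finally have "fact m * (\<Prod>j<r. real (m + 2 + 2 * j)) \<le> fact m * (2 ^ r * 2 ^ r * 2 ^ m * fact r)"
    by (simp add: power_add mult_ac)
  then show ?thesis by (simp flip: power_mult_distrib)
qed

text \<open>
  The coefficients of the system grow only linearly in the size of the index, so that iterating the
  integral equation \<open>r\<close> times costs \<open>\<Prod>j\<le>r. (m + 2 j) \<approx> 2\<^sup>r r!\<close>, which \<open>t\<^sup>r / r!\<close> beats for short
  times of a length not depending on the solution.
\<close>

lemma banded_ode_unique_step:
  fixes x D :: "real \<Rightarrow> 'k \<Rightarrow> complex" and sz :: "'k \<Rightarrow> nat"
  assumes deriv: "\<And>t k. ((\<lambda>t. x t k) has_vector_derivative D t k) (at t)"
    and D_le: "\<And>t k b. (\<And>l. sz l \<le> sz k + 2 \<Longrightarrow> cmod (x t l) \<le> b) \<Longrightarrow> cmod (D t k) \<le> K * real (sz k + 2) * b"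
    and growth: "\<And>t k. t \<in> {t0..t1} \<Longrightarrow> cmod (x t k) \<le> C * real (sz k + 1)"
    and "K > 0" "C \<ge> 0" "\<And>k. x t0 k = 0" "t0 \<le> t1" "8 * K * (t1 - t0) \<le> 1"
  shows "x t1 k = 0"
proof -
  let ?P = "\<lambda>r m. \<Prod>j<r. real (m + 2 + 2 * j)"
  \<comment> \<open>The bound after r iterations: the growth hypothesis at size m + 2r, the largest
    size reached in r steps; the product of the r coefficient bounds met on the way, with K^r taken
    out; and t^r / r! from r nested integrations.\<close>
  define b where "b = (\<lambda>r m t. C * real (m + 2 * r + 1) * ?P r m * ((K * (t - t0)) ^ r / fact r))"
  have b_mono: "b r m t \<le> b r m' t" if "m \<le> m'" "t \<ge> t0" for r m m' t
    unfolding b_def using that \<open>K > 0\<close> \<open>C \<ge> 0\<close>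
    by (intro mult_mono mult_nonneg_nonneg prod_mono prod_nonneg divide_nonneg_nonneg zero_le_power) auto
  have iterate: "cmod (x t k) \<le> b r (sz k) t" if "t \<in> {t0..t1}" for t k r
    using that
  proof (induction r arbitrary: t k)
    case 0
    then show ?case using growth by (simp add: b_def)
  next
    case (Suc r)
    let ?m = "sz k"
    let ?c = "C * real (?m + 2 * Suc r + 1) * ?P (Suc r) ?m"
    have D: "cmod (D \<tau> k) \<le> ?c * (K * (K * (\<tau> - t0)) ^ r / fact r)" if "\<tau> \<in> {t0..t}" for \<tau>
    proof -
      have "cmod (D \<tau> k) \<le> K * real (?m + 2) * b r (?m + 2) \<tau>"
      proof (rule D_le)
        fix l assume "sz l \<le> ?m + 2"
        then show "cmod (x \<tau> l) \<le> b r (?m + 2) \<tau>"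
          using Suc.IH[of \<tau> l] Suc.prems that b_mono[of "sz l" "?m + 2" \<tau> r] by force
      qed
      then show ?thesis
        unfolding b_def prod_arith_progression_Suc by (simp add: mult_ac)
    qed
    show ?case
    proof (cases "t = t0")
      case True
      then show ?thesis using assms(6) by (simp add: b_def)
    next
      case False
      have "((\<lambda>t. b (Suc r) ?m t) has_real_derivative ?c * (K * (K * (\<tau> - t0)) ^ r / fact r)) (at \<tau>)" for \<tau>
      proof -
        have "((\<lambda>t. (K * (t - t0)) ^ Suc r / fact (Suc r)) has_real_derivative
            ((1 + of_nat r) * (K * (K * (\<tau> - t0)) ^ r)) / fact (Suc r)) (at \<tau>)"
          by (rule DERIV_cdivide, rule DERIV_power_Suc) (auto intro!: derivative_eq_intros)
        then have "((\<lambda>t. (K * (t - t0)) ^ Suc r / fact (Suc r)) has_real_derivative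
            K * (K * (\<tau> - t0)) ^ r / fact r) (at \<tau>)"
          by (simp add: divide_simps del: power_Suc)
        then show ?thesis unfolding b_def by (rule DERIV_cmult)
      qed
      then have b': "(b (Suc r) ?m has_vector_derivative ?c * (K * (K * (\<tau> - t0)) ^ r / fact r)) (at \<tau>)" for \<tau>
        by (simp add: has_real_derivative_iff_has_vector_derivative)
      \<comment> \<open>Instead of integrating the bound on \<open>D\<close>, its antiderivative
        \<open>b (Suc r) ?m\<close> is compared with \<open>x\<close> through the mean value
        inequality.\<close>
      have "cmod (x t k - x t0 k) \<le> b (Suc r) ?m t - b (Suc r) ?m t0"
      proof (rule differentiable_bound_general[OF _ _ _ deriv b'])
        show "continuous_on {t0..t} (\<lambda>t. x t k)" "continuous_on {t0..t} (b (Suc r) ?m)"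
          by (rule continuous_on_vector_derivative, rule has_vector_derivative_at_within, rule deriv b')+
      qed (use Suc.prems False D in auto)
      then show ?thesis using assms(6) by (simp add: b_def)
    qed
  qed
  \<comment> \<open>Here the 8 in the hypothesis on t1 - t0 is spent: against the rate 4^r it leaves
    (1/2)^r, which beats the linear factor m + 2r + 1.\<close>
  have b_le: "b r m t1 \<le> C * 2 ^ m * (real (m + 2 * r + 1) * (1 / 2) ^ r)" for r m
  proof -
    have "?P r m * ((K * (t1 - t0)) ^ r / fact r) \<le> (4 ^ r * 2 ^ m * fact r) * ((1 / 8) ^ r / fact r)"
      using assms by (intro mult_mono prod_arith_progression_le divide_right_mono power_mono) auto
    also have "\<dots> = 2 ^ m * (4 * (1 / 8)) ^ r" by (simp only: power_mult_distrib) simp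
    also have "4 * (1 / 8) = (1 / 2 :: real)" by simp
    finally have "C * real (m + 2 * r + 1) * (?P r m * ((K * (t1 - t0)) ^ r / fact r))
        \<le> C * real (m + 2 * r + 1) * (2 ^ m * (1 / 2) ^ r)"
      using \<open>C \<ge> 0\<close> by (intro mult_left_mono) auto
    then show ?thesis unfolding b_def by (simp only: mult_ac)
  qed
  have "(\<lambda>r. C * 2 ^ m * (real (m + 1) * (1 / 2) ^ r + 2 * (real r * (1 / 2) ^ r))) \<longlonglongrightarrow>
      C * 2 ^ m * (real (m + 1) * 0 + 2 * 0)" for m
    by (intro tendsto_intros powser_times_n_limit_0 LIMSEQ_power_zero) auto
  then have lim: "(\<lambda>r. C * 2 ^ m * (real (m + 2 * r + 1) * (1 / 2) ^ r)) \<longlonglongrightarrow> 0" for m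
    by (simp add: algebra_simps)
  have "cmod (x t1 k) \<le> C * 2 ^ sz k * (real (sz k + 2 * r + 1) * (1 / 2) ^ r)" for r
    using iterate[of t1 k r] b_le[of r "sz k"] \<open>t0 \<le> t1\<close> by auto
  then have "cmod (x t1 k) \<le> 0" by (intro LIMSEQ_le_const[OF lim[of "sz k"]]) blast
  then show ?thesis by simp
qed

text \<open>Steps of the fixed length 1 / (8 K) reach every time. The growth constant may depend on
  the time window, since the step length does not depend on it.\<close>

lemma banded_ode_unique_nonneg:
  fixes x D :: "real \<Rightarrow> 'k \<Rightarrow> complex" and sz :: "'k \<Rightarrow> nat"
  assumes deriv: "\<And>t k. ((\<lambda>t. x t k) has_vector_derivative D t k) (at t)"
    and D_le: "\<And>t k b. (\<And>l. sz l \<le> sz k + 2 \<Longrightarrow> cmod (x t l) \<le> b) \<Longrightarrow> cmod (D t k) \<le> K * real (sz k + 2) * b"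
    and growth: "\<And>T. \<exists>C\<ge>0. \<forall>t k. \<bar>t\<bar> \<le> T \<longrightarrow> cmod (x t k) \<le> C * real (sz k + 1)"
    and "K > 0" "\<And>k. x 0 k = 0" "t \<ge> 0"
  shows "x t k = 0"
proof -
  have "\<forall>t k. 0 \<le> t \<and> t \<le> real n / (8 * K) \<longrightarrow> x t k = 0" for n
  proof (induction n)
    case 0
    then show ?case using assms(5) by auto
  next
    case (Suc n)
    let ?t0 = "real n / (8 * K)"
    have "x t k = 0" if "0 \<le> t" "t \<le> real (Suc n) / (8 * K)" for t k
    proof (cases "t \<le> ?t0")
      case False
      obtain C where C: "C \<ge> 0" "\<And>s k. \<bar>s\<bar> \<le> t \<Longrightarrow> cmod (x s k) \<le> C * real (sz k + 1)"
        using growth by blast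
      have "?t0 \<ge> 0" using \<open>K > 0\<close> by simp
      have "t * (8 * K) \<le> real (Suc n)" using that \<open>K > 0\<close> by (simp add: pos_le_divide_eq)
      moreover have "8 * K * ?t0 = real n" using \<open>K > 0\<close> by simp
      ultimately have short: "8 * K * (t - ?t0) \<le> 1" by (simp add: right_diff_distrib mult_ac)
      show ?thesis
      proof (rule banded_ode_unique_step[OF deriv D_le _ \<open>K > 0\<close> C(1) _ _ short])
        show "cmod (x s k) \<le> C * real (sz k + 1)" if "s \<in> {?t0..t}" for s k
          using that \<open>?t0 \<ge> 0\<close> by (intro C(2)) auto
        show "x ?t0 k = 0" for k using Suc \<open>?t0 \<ge> 0\<close> by blast
        show "?t0 \<le> t" using False by simp
      qed
    qed (use Suc that in auto)
    then show ?case by blast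
  qed
  moreover obtain n where "t * (8 * K) \<le> real n" using real_arch_simple by blast
  then have "t \<le> real n / (8 * K)" using \<open>K > 0\<close> by (simp add: pos_le_divide_eq)
  ultimately show ?thesis using \<open>t \<ge> 0\<close> by blast
qed

lemma banded_ode_unique:
  fixes x D :: "real \<Rightarrow> 'k \<Rightarrow> complex" and sz :: "'k \<Rightarrow> nat"
  assumes deriv: "\<And>t k. ((\<lambda>t. x t k) has_vector_derivative D t k) (at t)"
    and D_le: "\<And>t k b. (\<And>l. sz l \<le> sz k + 2 \<Longrightarrow> cmod (x t l) \<le> b) \<Longrightarrow> cmod (D t k) \<le> K * real (sz k + 2) * b"
    and growth: "\<And>T. \<exists>C\<ge>0. \<forall>t k. \<bar>t\<bar> \<le> T \<longrightarrow> cmod (x t k) \<le> C * real (sz k + 1)"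
    and "K > 0" "\<And>k. x 0 k = 0"
  shows "x t k = 0"
proof (cases "t \<ge> 0")
  case True
  show ?thesis
    by (rule banded_ode_unique_nonneg[where x = x and D = D and sz = sz and K = K])
      (fact deriv D_le growth assms(4,5) True)+
next
  case False
  \<comment> \<open>Time reversal: the reversed solution has right-hand side - D(- t), of the same
    size, and is evaluated at the positive time - t.\<close>
  have "x (- (- t)) k = 0"
  proof (rule banded_ode_unique_nonneg[where x = "\<lambda>t. x (- t)" and D = "\<lambda>t k. - D (- t) k" and sz = sz and K = K])
    show "((\<lambda>t. x (- t) k) has_vector_derivative - D (- t) k) (at t)" for t k
      using vector_diff_chain_at[of uminus "-1" t "\<lambda>t. x t k", OF _ deriv]
      by (simp add: o_def has_vector_derivative_minus has_vector_derivative_id)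
    show "cmod (- D (- t) k) \<le> K * real (sz k + 2) * b"
      if "\<And>l. sz l \<le> sz k + 2 \<Longrightarrow> cmod (x (- t) l) \<le> b" for t k b
      unfolding norm_minus_cancel by (rule D_le) (rule that)
    show "\<exists>C\<ge>0. \<forall>t k. \<bar>t\<bar> \<le> T \<longrightarrow> cmod (x (- t) k) \<le> C * real (sz k + 1)" for T
      using growth[of T] by (metis abs_minus_cancel)
  qed (use assms(4,5) False in auto)
  then show ?thesis by simp
qed

section \<open>Commutators with the Hamiltonian\<close>

lemma annih_linear:
  "annih p (\<lambda>k. f k + g k) = (\<lambda>k. annih p f k + annih p g k)"
  "annih p (\<lambda>k. f k - g k) = (\<lambda>k. annih p f k - annih p g k)"
  "annih p (\<lambda>k. c * f k) = (\<lambda>k. c * annih p f k)"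
  "annih p (\<lambda>k. \<Sum>i\<in>S. F i k) = (\<lambda>k. \<Sum>i\<in>S. annih p (F i) k)"
  "annih p (\<lambda>k. if P then f k else 0) = (\<lambda>k. if P then annih p f k else 0)"
  by (simp_all add: annih_def fun_eq_iff algebra_simps sum_distrib_left)

lemma creat_linear:
  "creat p (\<lambda>k. f k + g k) = (\<lambda>k. creat p f k + creat p g k)"
  "creat p (\<lambda>k. f k - g k) = (\<lambda>k. creat p f k - creat p g k)"
  "creat p (\<lambda>k. c * f k) = (\<lambda>k. c * creat p f k)"
  "creat p (\<lambda>k. \<Sum>i\<in>S. F i k) = (\<lambda>k. \<Sum>i\<in>S. creat p (F i) k)"
  "creat p (\<lambda>k. if P then f k else 0) = (\<lambda>k. if P then creat p f k else 0)"
  by (simp_all add: creat_def fun_eq_iff algebra_simps sum_distrib_left)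

lemma annih_commute: "annih i (annih j f) = annih j (annih i f)"
  by (cases "i = j") (auto simp: annih_def fun_eq_iff fun_upd_twist)

lemma creat_commute: "creat i (creat j f) = creat j (creat i f)"
  by (cases "i = j") (auto simp: creat_def fun_eq_iff fun_upd_twist)

lemma of_real_sqrt_mult_self: "x \<ge> 0 \<Longrightarrow> complex_of_real (sqrt x) * (complex_of_real (sqrt x) * z) = of_real x * z"
  by (simp flip: of_real_mult mult.assoc)

text \<open>The canonical commutation relation, on arbitrary amplitude functions. In the case i = j
  the truncated subtraction gives a wrong index when \<open>k i = 0\<close>, but the factor sqrt 0
  removes that term.\<close>

lemma annih_creat: "annih i (creat j f) = (\<lambda>k. creat j (annih i f) k + (if i = j then f k else 0))"
proof (cases "i = j")
  case True
  show ?thesis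
  proof
    fix k :: "'a \<Rightarrow> nat"
    have "complex_of_real (sqrt (real (k i))) * (complex_of_real (sqrt (real (k i - 1 + 1))) * f (k(i := k i - 1 + 1)))
      = of_real (real (k i)) * f k"
      by (cases "k i") (simp_all add: of_real_sqrt_mult_self fun_upd_idem del: of_nat_Suc)
    then show "annih i (creat j f) k = creat j (annih i f) k + (if i = j then f k else 0)"
      using True by (simp add: annih_def creat_def of_real_sqrt_mult_self distrib_right)
  qed
qed (auto simp: annih_def creat_def fun_eq_iff fun_upd_twist)

lemma sum_sum_delta:
  fixes M :: "'a::semiring_0^'n^('n::finite)"
  shows "(\<Sum>i\<in>UNIV. \<Sum>j\<in>UNIV. M $ i $ j * (if p = i then g j else 0)) = (\<Sum>j\<in>UNIV. M $ p $ j * g j)"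
    and "(\<Sum>i\<in>UNIV. \<Sum>j\<in>UNIV. M $ i $ j * (if p = j then g i else 0)) = (\<Sum>j\<in>UNIV. M $ j $ p * g j)"
  by (subst sum.swap) (simp_all add: if_distrib[of "\<lambda>x. _ * x"] cong: if_cong)

lemma annih_op_quad_creat_creat:
  "annih p (op_quad creat M creat f) =
    (\<lambda>k. op_quad creat M creat (annih p f) k + (\<Sum>j\<in>UNIV. M $ p $ j * creat j f k) + (\<Sum>j\<in>UNIV. M $ j $ p * creat j f k))"
  unfolding op_quad_def
  by (simp add: annih_linear annih_creat creat_linear distrib_left sum.distrib sum_sum_delta add_ac)

lemma annih_op_quad_creat_annih:
  "annih p (op_quad creat M annih f) =
    (\<lambda>k. op_quad creat M annih (annih p f) k + (\<Sum>j\<in>UNIV. M $ p $ j * annih j f k))"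
  unfolding op_quad_def
  by (simp add: annih_linear annih_creat annih_commute[of p] distrib_left sum.distrib sum_sum_delta)

lemma annih_op_quad_annih_annih:
  "annih p (op_quad annih M annih f) = op_quad annih M annih (annih p f)"
  unfolding op_quad_def by (simp add: annih_linear annih_commute[of p])

lemma creat_op_quad_creat_creat:
  "creat p (op_quad creat M creat f) = op_quad creat M creat (creat p f)"
  unfolding op_quad_def by (simp add: creat_linear creat_commute[of p])

lemma creat_op_quad_creat_annih:
  "creat p (op_quad creat M annih f) =
    (\<lambda>k. op_quad creat M annih (creat p f) k - (\<Sum>j\<in>UNIV. M $ j $ p * creat j f k))"
  unfolding op_quad_def
  by (simp add: creat_linear annih_creat creat_commute[of p] distrib_left sum.distrib sum_sum_delta
      eq_commute[of _ p])

lemma creat_op_quad_annih_annih: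
  "creat p (op_quad annih M annih f) =
    (\<lambda>k. op_quad annih M annih (creat p f) k - (\<Sum>j\<in>UNIV. M $ p $ j * annih j f k) - (\<Sum>j\<in>UNIV. M $ j $ p * annih j f k))"
  unfolding op_quad_def
  by (simp add: creat_linear annih_creat annih_linear distrib_left sum.distrib sum_sum_delta
      eq_commute[of _ p])

lemma annih_op_lin_creat:
  "annih p (op_lin creat v f) = (\<lambda>k. op_lin creat v (annih p f) k + v $ p * f k)"
  unfolding op_lin_def
  by (simp add: annih_linear annih_creat distrib_left sum.distrib if_distrib[of "\<lambda>x. _ * x"] cong: if_cong)

lemma annih_op_lin_annih: "annih p (op_lin annih v f) = op_lin annih v (annih p f)"
  unfolding op_lin_def by (simp add: annih_linear annih_commute[of p])

lemma creat_op_lin_creat: "creat p (op_lin creat v f) = op_lin creat v (creat p f)"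
  unfolding op_lin_def by (simp add: creat_linear creat_commute[of p])

lemma creat_op_lin_annih:
  "creat p (op_lin annih v f) = (\<lambda>k. op_lin annih v (creat p f) k - v $ p * f k)"
  unfolding op_lin_def
  by (simp add: creat_linear annih_creat distrib_left sum.distrib if_distrib[of "\<lambda>x. _ * x"] cong: if_cong)

text \<open>The commutator is i times row \<open>Inl p\<close> of the classical system with matrix
  \<open>G_mat\<close> and forcing \<open>doubled h\<close>; for the creation operator it will be
  row \<open>Inr p\<close>. Symmetry of \<open>A\<close> makes the two contributions of the
  quadratic term equal, cancelling its factor 1/2.\<close>

lemma annih_ham_expr:
  assumes "A = transpose A"
  shows "annih p (ham_expr A B h f) k = ham_expr A B h (annih p f) k
    + \<i> * (\<Sum>j\<in>UNIV. A $ p $ j * creat j f k) + (\<Sum>j\<in>UNIV. B $ p $ j * annih j f k) + \<i> * h $ p * f k"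
proof -
  have "A $ i $ j = A $ j $ i" for i j
    using arg_cong[OF assms, of "\<lambda>M. M $ i $ j"] by (simp add: transpose_def)
  then have "(\<Sum>j\<in>UNIV. A $ j $ p * creat j f k) = (\<Sum>j\<in>UNIV. A $ p $ j * creat j f k)" by simp
  then show ?thesis
    unfolding ham_expr_def annih_linear annih_op_quad_creat_creat annih_op_quad_creat_annih
      annih_op_quad_annih_annih annih_op_lin_creat annih_op_lin_annih
    by (simp add: algebra_simps)
qed

lemma creat_ham_expr:
  assumes "A = transpose A" "B = cnj_mat (transpose B)"
  shows "creat p (ham_expr A B h f) k = ham_expr A B h (creat p f) k
    + \<i> * (\<Sum>j\<in>UNIV. cnj (A $ p $ j) * annih j f k) - (\<Sum>j\<in>UNIV. cnj (B $ p $ j) * creat j f k) + \<i> * cnj (h $ p) * f k"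
proof -
  have "A $ i $ j = A $ j $ i" "cnj (B $ i $ j) = B $ j $ i" for i j
    using arg_cong[OF assms(1), of "\<lambda>M. M $ i $ j"] arg_cong[OF assms(2), of "\<lambda>M. M $ j $ i"]
    by (simp_all add: transpose_def cnj_mat_def)
  then have "(\<Sum>j\<in>UNIV. cnj_mat A $ j $ p * annih j f k) = (\<Sum>j\<in>UNIV. cnj (A $ p $ j) * annih j f k)"
    "(\<Sum>j\<in>UNIV. B $ j $ p * creat j f k) = (\<Sum>j\<in>UNIV. cnj (B $ p $ j) * creat j f k)"
    by (simp_all add: cnj_mat_def)
  then show ?thesis
    unfolding ham_expr_def creat_linear creat_op_quad_creat_creat creat_op_quad_creat_annih
      creat_op_quad_annih_annih creat_op_lin_creat creat_op_lin_annih
    by (simp add: algebra_simps) (simp add: cnj_mat_def cnj_vec_def)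
qed

section \<open>Amplitudes of the unitary evolution\<close>

definition fin_supp :: "('a \<Rightarrow> complex) \<Rightarrow> bool" where
  "fin_supp f \<longleftrightarrow> finite {k. f k \<noteq> 0}"

text \<open>With a finitely supported left argument the right one may be any amplitude function,
  square summable or not, so operators can be moved across with no domain condition.\<close>

definition pairing :: "('a \<Rightarrow> complex) \<Rightarrow> ('a \<Rightarrow> complex) \<Rightarrow> complex" where
  "pairing f g = (\<Sum>\<^sub>\<infinity>k. cnj (f k) * g k)"

lemma fin_supp_add: "fin_supp f \<Longrightarrow> fin_supp g \<Longrightarrow> fin_supp (\<lambda>k. f k + g k)"
  and fin_supp_diff: "fin_supp f \<Longrightarrow> fin_supp g \<Longrightarrow> fin_supp (\<lambda>k. f k - g k)"
  unfolding fin_supp_def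
  by (erule (1) finite_subset[rotated, OF finite_UnI], auto)+

lemma fin_supp_mult: "fin_supp f \<Longrightarrow> fin_supp (\<lambda>k. c * f k)"
  unfolding fin_supp_def by (erule finite_subset[rotated]) auto

lemma fin_supp_sum: "(\<And>i. i \<in> S \<Longrightarrow> fin_supp (F i)) \<Longrightarrow> fin_supp (\<lambda>k. \<Sum>i\<in>S. F i k)"
  by (induction S rule: infinite_finite_induct) (auto intro: fin_supp_add simp: fin_supp_def[of "\<lambda>_. 0"])

lemma fin_supp_annih: "fin_supp f \<Longrightarrow> fin_supp (annih i f)"
  unfolding fin_supp_def
proof (erule finite_surj)
  show "{k. annih i f k \<noteq> 0} \<subseteq> (\<lambda>k. k(i := k i - 1)) ` {k. f k \<noteq> 0}"
  proof
    fix k assume "k \<in> {k. annih i f k \<noteq> 0}"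
    then have "k(i := k i + 1) \<in> {k. f k \<noteq> 0}" by (simp add: annih_def)
    then show "k \<in> (\<lambda>k. k(i := k i - 1)) ` {k. f k \<noteq> 0}" by (rule rev_image_eqI) simp
  qed
qed

lemma fin_supp_creat: "fin_supp f \<Longrightarrow> fin_supp (creat i f)"
  unfolding fin_supp_def
proof (erule finite_surj)
  show "{k. creat i f k \<noteq> 0} \<subseteq> (\<lambda>k. k(i := k i + 1)) ` {k. f k \<noteq> 0}"
  proof
    fix k assume "k \<in> {k. creat i f k \<noteq> 0}"
    then have "k(i := k i - 1) \<in> {k. f k \<noteq> 0}" "k i \<noteq> 0" by (auto simp: creat_def)
    then show "k \<in> (\<lambda>k. k(i := k i + 1)) ` {k. f k \<noteq> 0}"
      by (intro rev_image_eqI) (auto simp: fun_upd_idem)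
  qed
qed

lemmas fin_supp_intros = fin_supp_add fin_supp_diff fin_supp_mult fin_supp_sum fin_supp_annih fin_supp_creat

lemma fin_supp_ham_expr:
  "fin_supp f \<Longrightarrow> fin_supp (op_quad creat A creat f)"
  "fin_supp f \<Longrightarrow> fin_supp (op_quad annih A annih f)"
  "fin_supp f \<Longrightarrow> fin_supp (op_quad creat A annih f)"
  "fin_supp f \<Longrightarrow> fin_supp (op_lin creat h f)"
  "fin_supp f \<Longrightarrow> fin_supp (op_lin annih h f)"
  "fin_supp f \<Longrightarrow> fin_supp (ham_expr A B h f)"
  unfolding ham_expr_def op_quad_def op_lin_def by (intro fin_supp_intros; assumption)+

lemma fin_supp_square_summable: "fin_supp f \<Longrightarrow> (\<lambda>k. (cmod (f k))\<^sup>2) summable_on UNIV"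
  unfolding fin_supp_def by (rule finite_nonzero_values_imp_summable_on) simp

lemma pairing_summable:
  "fin_supp f \<Longrightarrow> (\<lambda>k. cnj (f k) * g k) summable_on UNIV"
  unfolding fin_supp_def by (rule finite_nonzero_values_imp_summable_on, erule finite_subset[rotated]) auto

lemma pairing_mult_left: "pairing (\<lambda>k. c * f k) g = cnj c * pairing f g"
  and pairing_mult_right: "pairing f (\<lambda>k. c * g k) = c * pairing f g"
  unfolding pairing_def by (simp_all add: mult.assoc mult.left_commute[of _ c] infsum_cmult_right')

lemma pairing_add_left: "fin_supp f \<Longrightarrow> fin_supp f' \<Longrightarrow> pairing (\<lambda>k. f k + f' k) g = pairing f g + pairing f' g"
  and pairing_add_right: "fin_supp f \<Longrightarrow> pairing f (\<lambda>k. g k + g' k) = pairing f g + pairing f g'"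
  unfolding pairing_def by (simp_all add: distrib_left distrib_right infsum_add pairing_summable)

lemma pairing_diff_left: "fin_supp f \<Longrightarrow> fin_supp f' \<Longrightarrow> pairing (\<lambda>k. f k - f' k) g = pairing f g - pairing f' g"
  using pairing_add_left[of f "\<lambda>k. (- 1) * f' k" g] pairing_mult_left[of "- 1" f' g]
    fin_supp_mult[of f' "- 1"] by simp

lemma pairing_diff_right: "fin_supp f \<Longrightarrow> pairing f (\<lambda>k. g k - g' k) = pairing f g - pairing f g'"
  using pairing_add_right[of f g "\<lambda>k. (- 1) * g' k"] pairing_mult_right[of f "- 1" g'] by simp

lemma pairing_sum_left:
  "(\<And>i. i \<in> S \<Longrightarrow> fin_supp (F i)) \<Longrightarrow> pairing (\<lambda>k. \<Sum>i\<in>S. F i k) g = (\<Sum>i\<in>S. pairing (F i) g)"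
  by (induction S rule: infinite_finite_induct)
    (simp_all add: pairing_add_left fin_supp_sum, simp_all add: pairing_def)

lemma pairing_sum_right:
  "fin_supp f \<Longrightarrow> pairing f (\<lambda>k. \<Sum>i\<in>S. F i k) = (\<Sum>i\<in>S. pairing f (F i))"
  by (induction S rule: infinite_finite_induct)
    (simp_all add: pairing_add_right, simp_all add: pairing_def)

text \<open>Shifting mode i up by one misses only indices with \<open>k i = 0\<close>, where the
  square root vanishes. Since \<open>F\<close> sees both the shifted and the unshifted index, the
  lemma yields both adjointness relations between annihilation and creation.\<close>

lemma infsum_raise_index:
  fixes F :: "('a \<Rightarrow> nat) \<Rightarrow> ('a \<Rightarrow> nat) \<Rightarrow> complex"
  shows "(\<Sum>\<^sub>\<infinity>k. of_real (sqrt (real (k i))) * F k (k(i := k i - 1)))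
    = (\<Sum>\<^sub>\<infinity>k. of_real (sqrt (real (k i + 1))) * F (k(i := k i + 1)) k)"
proof -
  let ?s = "\<lambda>k::'a \<Rightarrow> nat. k(i := k i + 1)"
  let ?f = "\<lambda>k. of_real (sqrt (real (k i))) * F k (k(i := k i - 1))"
  have "inj ?s"
    by (rule inj_on_inverseI[where g = "\<lambda>k. k(i := k i - 1)"]) simp
  have "infsum ?f UNIV = infsum ?f (range ?s)"
  proof (rule infsum_cong_neutral)
    fix k assume "k \<in> UNIV - range ?s"
    moreover have "k = ?s (k(i := k i - 1))" if "k i \<noteq> 0" using that by (simp add: fun_upd_idem)
    ultimately have "k i = 0" by blast
    then show "?f k = 0" by simp
  qed auto
  also have "\<dots> = infsum (?f \<circ> ?s) UNIV" by (rule infsum_reindex[OF \<open>inj ?s\<close>])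
  finally show ?thesis by (simp add: o_def)
qed

lemma pairing_creat_left: "pairing (creat i f) g = pairing f (annih i g)"
  using infsum_raise_index[of i "\<lambda>k l. cnj (f l) * g k"]
  by (simp add: pairing_def creat_def annih_def mult_ac)

lemma pairing_annih_left: "pairing (annih i f) g = pairing f (creat i g)"
  using infsum_raise_index[of i "\<lambda>k l. cnj (f k) * g l"]
  by (simp add: pairing_def creat_def annih_def mult_ac)

lemma pairing_op_quad:
  assumes "fin_supp f"
  shows "pairing (op_quad creat M creat f) g = pairing f (op_quad annih (cnj_mat M) annih g)"
    and "pairing (op_quad annih M annih f) g = pairing f (op_quad creat (cnj_mat M) creat g)"
    and "pairing (op_quad creat M annih f) g = pairing f (op_quad creat (cnj_mat (transpose M)) annih g)"
proof -
  show "pairing (op_quad creat M creat f) g = pairing f (op_quad annih (cnj_mat M) annih g)"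
    unfolding op_quad_def
    by (simp add: pairing_sum_left pairing_sum_right pairing_mult_left pairing_mult_right
        fin_supp_intros assms pairing_creat_left cnj_mat_def annih_commute)
  show "pairing (op_quad annih M annih f) g = pairing f (op_quad creat (cnj_mat M) creat g)"
    unfolding op_quad_def
    by (simp add: pairing_sum_left pairing_sum_right pairing_mult_left pairing_mult_right
        fin_supp_intros assms pairing_annih_left cnj_mat_def creat_commute)
  show "pairing (op_quad creat M annih f) g = pairing f (op_quad creat (cnj_mat (transpose M)) annih g)"
    unfolding op_quad_def
    by (simp add: pairing_sum_left pairing_sum_right pairing_mult_left pairing_mult_right
        fin_supp_intros assms pairing_annih_left pairing_creat_left cnj_mat_def transpose_def)
      (rule sum.swap)
qed

lemma pairing_op_lin:
  assumes "fin_supp f"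
  shows "pairing (op_lin creat v f) g = pairing f (op_lin annih (cnj_vec v) g)"
    and "pairing (op_lin annih v f) g = pairing f (op_lin creat (cnj_vec v) g)"
  unfolding op_lin_def
  by (simp_all add: pairing_sum_left pairing_sum_right pairing_mult_left pairing_mult_right
      fin_supp_intros assms pairing_annih_left pairing_creat_left cnj_vec_def)

lemma pairing_ham_expr:
  assumes "B = cnj_mat (transpose B)" "fin_supp f"
  shows "pairing (ham_expr A B h f) g = pairing f (ham_expr A B h g)"
proof -
  have "cnj_mat (cnj_mat A) = A" "cnj_vec (cnj_vec h) = h"
    by (simp_all add: cnj_mat_def cnj_vec_def vec_eq_iff)
  then show ?thesis
    unfolding ham_expr_def
    by (simp only: pairing_add_left pairing_diff_left pairing_add_right pairing_diff_right
        pairing_mult_left pairing_mult_right fin_supp_intros fin_supp_ham_expr pairing_op_quad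
        pairing_op_lin assms(1)[symmetric] assms(2)) (simp add: algebra_simps)
qed

section \<open>Number states and the inner product of the Fock space\<close>

definition number_amp :: "'a \<Rightarrow> 'a \<Rightarrow> complex" where
  "number_amp k = (\<lambda>l. if l = k then 1 else 0)"

lemma fin_supp_number_amp: "fin_supp (number_amp k)"
  by (simp add: fin_supp_def number_amp_def)

lemma pairing_number_amp: "pairing (number_amp k) g = g k"
proof -
  have "pairing (number_amp k) g = (\<Sum>\<^sub>\<infinity>l\<in>{k}. g l)"
    unfolding pairing_def number_amp_def by (rule infsum_cong_neutral) auto
  then show ?thesis by simp
qed

lemma braket_eq_pairing: "braket \<phi> \<psi> = pairing (amp \<phi>) (amp \<psi>)"
  by (simp add: braket_def pairing_def)

lemma amp_Abs_fin_supp: "fin_supp f \<Longrightarrow> amp (Abs_fock f) = f"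
  by (intro amp_Abs fin_supp_square_summable)

lemma braket_Abs_number_amp: "braket (Abs_fock (number_amp k)) \<psi> = amp \<psi> k"
  by (simp add: braket_eq_pairing amp_Abs_fin_supp fin_supp_number_amp pairing_number_amp)

lemma number_amp_in_ham:
  "(Abs_fock (number_amp k), Abs_fock (ham_expr A B h (number_amp k))) \<in> ham A B h"
proof -
  have "finite_particle (Abs_fock (number_amp k))"
    unfolding finite_particle_def amp_Abs_fin_supp[OF fin_supp_number_amp]
    by (auto simp: number_amp_def intro!: exI[of _ "\<Sum>i\<in>UNIV. k i"])
  then show ?thesis
    unfolding ham_def ham0_def
    by (intro closure_subset[THEN subsetD])
      (simp add: amp_Abs_fin_supp fin_supp_number_amp fin_supp_ham_expr)
qed

lemma braket_add_left: "braket (\<phi> + \<phi>') \<psi> = braket \<phi> \<psi> + braket \<phi>' \<psi>"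
  by (simp add: braket_def amp_simps distrib_right infsum_add[OF braket_summable braket_summable])

lemma braket_scale_left: "braket (cscale c \<phi>) \<psi> = cnj c * braket \<phi> \<psi>"
  by (simp add: braket_def amp_simps mult.assoc infsum_cmult_right')

lemma braket_diff_left: "braket (\<phi> - \<phi>') \<psi> = braket \<phi> \<psi> - braket \<phi>' \<psi>"
  by (simp only: minus_fock_def uminus_fock_def braket_add_left braket_scale_left) simp

lemma braket_scaleR_left: "braket (r *\<^sub>R \<phi>) \<psi> = of_real r * braket \<phi> \<psi>"
  by (simp add: scaleR_fock_def braket_scale_left)

text \<open>The Fock space carries a real inner product; the imaginary part is recovered by rotating
  one argument by - i, which transfers continuity to the complex bracket.\<close>

lemma braket_eq_inner: "braket \<phi> \<psi> = Complex (\<phi> \<bullet> \<psi>) (\<phi> \<bullet> cscale (- \<i>) \<psi>)"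
proof -
  have "braket \<phi> (cscale (- \<i>) \<psi>) = - \<i> * braket \<phi> \<psi>"
    unfolding braket_def amp_cscale by (simp only: mult.left_commute[of _ "- \<i>"] infsum_cmult_right')
  then show ?thesis by (simp add: inner_fock_def complex_eq_iff)
qed

lemma tendsto_braket_left: "(f \<longlongrightarrow> \<phi>) F \<Longrightarrow> ((\<lambda>x. braket (f x) \<psi>) \<longlongrightarrow> braket \<phi> \<psi>) F"
  unfolding braket_eq_inner by (intro tendsto_Complex tendsto_inner tendsto_const)

lemma cmod_amp_le: "cmod (amp \<psi> k) \<le> norm \<psi>"
proof -
  have "(cmod (amp \<psi> k))\<^sup>2 = (\<Sum>\<^sub>\<infinity>l\<in>{k}. (cmod (amp \<psi> l))\<^sup>2)" by simp
  also have "\<dots> \<le> (\<Sum>\<^sub>\<infinity>l. (cmod (amp \<psi> l))\<^sup>2)"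
    by (rule infsum_mono2) (auto intro: amp_summable)
  also have "\<dots> = (norm \<psi>)\<^sup>2"
    by (simp add: power2_norm_eq_inner inner_fock_def Re_braket_self)
  finally show ?thesis by (simp add: power2_le_iff_abs_le)
qed

lemma norm_vacuum: "norm (vacuum :: 'n::finite fock) = 1"
proof -
  have "vacuum = Abs_fock (number_amp (\<lambda>_::'n. 0))"
    by (simp add: vacuum_def number_amp_def)
  then have "braket (vacuum :: 'n fock) vacuum = 1"
    using braket_Abs_number_amp[of "\<lambda>_::'n. 0" vacuum] by (simp add: amp_vacuum)
  then show ?thesis by (simp add: norm_eq_sqrt_inner inner_fock_def)
qed

lemma braket_vacuum: "braket vacuum \<psi> = amp \<psi> (\<lambda>_. 0)"
  using braket_Abs_number_amp[of "\<lambda>_. 0" \<psi>] by (simp add: vacuum_def number_amp_def)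

lemma unitary_group_braket_move:
  assumes "unitary_group U"
  shows "braket \<phi> (U t \<psi>) = braket (U (- t) \<phi>) \<psi>"
proof -
  have "U (t + - t) = U t \<circ> U (- t)" "U 0 = id" "unitary (U t)"
    using assms unfolding unitary_group_def by blast+
  then have "U t (U (- t) \<phi>) = \<phi>" by (metis add.right_inverse comp_apply id_apply)
  moreover have "braket (U t (U (- t) \<phi>)) (U t \<psi>) = braket (U (- t) \<phi>) \<psi>"
    using \<open>unitary (U t)\<close> unfolding unitary_def by blast
  ultimately show ?thesis by simp
qed

lemma has_vector_derivativeI_quotient:
  fixes f :: "real \<Rightarrow> 'a::real_normed_vector"
  assumes "((\<lambda>s. (f (t + s) - f t) /\<^sub>R s) \<longlongrightarrow> D) (at 0)"
  shows "(f has_vector_derivative D) (at t)"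
proof -
  have "((\<lambda>s. norm ((f (t + s) - f t) /\<^sub>R s - D)) \<longlongrightarrow> 0) (at 0)"
    using assms by (simp add: tendsto_norm_zero_iff LIM_zero_iff)
  moreover have "norm (f (t + s) - f t - s *\<^sub>R D) / norm s = norm ((f (t + s) - f t) /\<^sub>R s - D)"
    if "s \<noteq> 0" for s
  proof -
    have "(f (t + s) - f t) /\<^sub>R s - D = (f (t + s) - f t - s *\<^sub>R D) /\<^sub>R s"
      using that by (simp add: algebra_simps)
    then show ?thesis by (simp add: divide_inverse mult.commute)
  qed
  ultimately have "((\<lambda>s. norm (f (t + s) - f t - s *\<^sub>R D) / norm s) \<longlongrightarrow> 0) (at 0)"
    by (subst Lim_cong_within[where g = "\<lambda>s. norm ((f (t + s) - f t) /\<^sub>R s - D)"]) auto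
  then show ?thesis
    unfolding has_vector_derivative_def has_derivative_at by (simp add: bounded_linear_scaleR_left)
qed

text \<open>The equation holds for every \<psi>: unitarity moves the difference quotient onto a
  number state, where the generator is known, and formal symmetry brings the Hamiltonian back to the
  evolved amplitudes.\<close>

lemma amp_group_derivative:
  assumes "is_exp_i (ham A B h) U" "B = cnj_mat (transpose B)"
  shows "((\<lambda>t. amp (U t \<psi>) k) has_vector_derivative \<i> * ham_expr A B h (amp (U t \<psi>)) k) (at t)"
proof -
  have grp: "unitary_group U"
    and gen: "generator U = {(\<psi>, cscale \<i> \<phi>) | \<psi> \<phi>. (\<psi>, \<phi>) \<in> ham A B h}"
    using assms(1) unfolding is_exp_i_def by auto
  let ?e = "Abs_fock (number_amp k)" and ?he = "Abs_fock (ham_expr A B h (number_amp k))"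
  have "(?e, cscale \<i> ?he) \<in> generator U"
    unfolding gen using number_amp_in_ham by blast
  then have "((\<lambda>s. (U s ?e - ?e) /\<^sub>R s) \<longlongrightarrow> cscale \<i> ?he) (at 0)"
    by (simp add: generator_def)
  \<comment> \<open>The sign is reversed because the adjoint of \<open>U s\<close> is
    \<open>U (- s)\<close>.\<close>
  then have "((\<lambda>s. (U (- s) ?e - ?e) /\<^sub>R (- s)) \<longlongrightarrow> cscale \<i> ?he) (at 0)"
    by (rule filterlim_compose) (simp add: filterlim_def filtermap_at_minus)
  from tendsto_minus[OF tendsto_braket_left[OF this, of "U t \<psi>"]]
  have "((\<lambda>s. - braket ((U (- s) ?e - ?e) /\<^sub>R (- s)) (U t \<psi>)) \<longlongrightarrow> \<i> * braket ?he (U t \<psi>)) (at 0)"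
    by (simp add: braket_scale_left)
  moreover have "- braket ((U (- s) ?e - ?e) /\<^sub>R (- s)) (U t \<psi>) = (amp (U (t + s) \<psi>) k - amp (U t \<psi>) k) /\<^sub>R s" for s
  proof -
    have "U (t + s) \<psi> = U s (U t \<psi>)"
      using grp unfolding unitary_group_def by (metis add.commute comp_apply)
    then have "braket (U (- s) ?e) (U t \<psi>) = amp (U (t + s) \<psi>) k"
      using unitary_group_braket_move[OF grp, of ?e s "U t \<psi>"] by (simp add: braket_Abs_number_amp)
    then show ?thesis
      by (simp only: braket_scaleR_left braket_diff_left braket_Abs_number_amp)
        (simp add: scaleR_conv_of_real)
  qed
  moreover have "braket ?he (U t \<psi>) = ham_expr A B h (amp (U t \<psi>)) k"
    by (simp add: braket_eq_pairing amp_Abs_fin_supp fin_supp_ham_expr fin_supp_number_amp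
        pairing_ham_expr[OF assms(2)] pairing_number_amp)
  ultimately have "((\<lambda>s. (amp (U (t + s) \<psi>) k - amp (U t \<psi>) k) /\<^sub>R s) \<longlongrightarrow> \<i> * ham_expr A B h (amp (U t \<psi>)) k) (at 0)"
    by simp
  then show ?thesis by (rule has_vector_derivativeI_quotient)
qed

lemma cmod_amp_group_le:
  assumes "unitary_group U"
  shows "cmod (amp (U t \<psi>) k) \<le> norm \<psi>"
proof -
  have "braket (U t \<psi>) (U t \<psi>) = braket \<psi> \<psi>"
    using assms unfolding unitary_group_def unitary_def by blast
  then have "norm (U t \<psi>) = norm \<psi>" by (simp add: norm_eq_sqrt_inner inner_fock_def)
  then show ?thesis using cmod_amp_le[of "U t \<psi>" k] by simp
qed

section \<open>Operators linear in creation and annihilation\<close>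

lemma ham_expr_linear:
  "ham_expr A B h (\<lambda>k. f k + g k) = (\<lambda>k. ham_expr A B h f k + ham_expr A B h g k)"
  "ham_expr A B h (\<lambda>k. c * f k) = (\<lambda>k. c * ham_expr A B h f k)"
proof -
  have add: "op_quad creat M creat (\<lambda>k. f k + g k) = (\<lambda>k. op_quad creat M creat f k + op_quad creat M creat g k)"
    "op_quad annih M annih (\<lambda>k. f k + g k) = (\<lambda>k. op_quad annih M annih f k + op_quad annih M annih g k)"
    "op_quad creat M annih (\<lambda>k. f k + g k) = (\<lambda>k. op_quad creat M annih f k + op_quad creat M annih g k)"
    "op_lin creat v (\<lambda>k. f k + g k) = (\<lambda>k. op_lin creat v f k + op_lin creat v g k)"
    "op_lin annih v (\<lambda>k. f k + g k) = (\<lambda>k. op_lin annih v f k + op_lin annih v g k)" for M v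
    unfolding op_quad_def op_lin_def annih_linear creat_linear by (simp_all add: distrib_left sum.distrib)
  have mult: "op_quad creat M creat (\<lambda>k. c * f k) = (\<lambda>k. c * op_quad creat M creat f k)"
    "op_quad annih M annih (\<lambda>k. c * f k) = (\<lambda>k. c * op_quad annih M annih f k)"
    "op_quad creat M annih (\<lambda>k. c * f k) = (\<lambda>k. c * op_quad creat M annih f k)"
    "op_lin creat v (\<lambda>k. c * f k) = (\<lambda>k. c * op_lin creat v f k)"
    "op_lin annih v (\<lambda>k. c * f k) = (\<lambda>k. c * op_lin annih v f k)" for M v
    unfolding op_quad_def op_lin_def annih_linear creat_linear
    by (simp_all add: sum_distrib_left mult.left_commute)
  show "ham_expr A B h (\<lambda>k. f k + g k) = (\<lambda>k. ham_expr A B h f k + ham_expr A B h g k)"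
    "ham_expr A B h (\<lambda>k. c * f k) = (\<lambda>k. c * ham_expr A B h f k)"
    unfolding ham_expr_def add mult by (simp_all add: algebra_simps)
qed

lemma ham_expr_sum:
  "ham_expr A B h (\<lambda>k. \<Sum>i\<in>S. F i k) = (\<lambda>k. \<Sum>i\<in>S. ham_expr A B h (F i) k)"
proof (induction S rule: infinite_finite_induct)
  case (insert i S)
  then show ?case by (simp add: ham_expr_linear)
\<comment> \<open>Scaling by 0 shows that the zero function is mapped to zero, which settles empty
  and infinite index sets.\<close>
qed (use ham_expr_linear(2)[where c = 0 and f = "\<lambda>_. 0"] in simp_all)

definition field_op ::
  "complex^('n::finite) \<Rightarrow> complex^'n \<Rightarrow> complex \<Rightarrow> 'n amp_op" where
  "field_op u v c f = (\<lambda>k. (\<Sum>j\<in>UNIV. u $ j * annih j f k) + (\<Sum>j\<in>UNIV. v $ j * creat j f k) + c * f k)"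

text \<open>Commuting with a quadratic Hamiltonian preserves affine combinations of annihilation and
  creation operators, so the Heisenberg equation reduces to finitely many coefficients. The new
  linear coefficients are i (u, v) G and the new constant is i times the product of (u, v) with
  \<open>doubled h\<close>.\<close>

lemma field_op_ham_expr:
  assumes "A = transpose A" "B = cnj_mat (transpose B)"
  shows "field_op u v c (ham_expr A B h f) k = ham_expr A B h (field_op u v c f) k
    + field_op (u v* B + \<i> *s (v v* cnj_mat A)) (\<i> *s (u v* A) - v v* cnj_mat B)
        (\<i> * (scalar_product u h + scalar_product v (cnj_vec h))) f k"
proof -
  have "field_op u v c (ham_expr A B h f) k = ham_expr A B h (field_op u v c f) k
    + ((\<Sum>j\<in>UNIV. u $ j * (\<i> * (\<Sum>l\<in>UNIV. A $ j $ l * creat l f k) + (\<Sum>l\<in>UNIV. B $ j $ l * annih l f k) + \<i> * h $ j * f k))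
    + (\<Sum>j\<in>UNIV. v $ j * (\<i> * (\<Sum>l\<in>UNIV. cnj (A $ j $ l) * annih l f k) - (\<Sum>l\<in>UNIV. cnj (B $ j $ l) * creat l f k) + \<i> * cnj (h $ j) * f k)))"
    unfolding field_op_def ham_expr_linear ham_expr_sum
    by (simp add: annih_ham_expr[OF assms(1)] creat_ham_expr[OF assms] distrib_left right_diff_distrib
        sum.distrib sum_subtractf)
  also have "(\<Sum>j\<in>UNIV. u $ j * (\<i> * (\<Sum>l\<in>UNIV. A $ j $ l * creat l f k) + (\<Sum>l\<in>UNIV. B $ j $ l * annih l f k) + \<i> * h $ j * f k))
    = (\<Sum>l\<in>UNIV. \<Sum>j\<in>UNIV. \<i> * (u $ j * A $ j $ l) * creat l f k)
      + (\<Sum>l\<in>UNIV. \<Sum>j\<in>UNIV. u $ j * B $ j $ l * annih l f k) + (\<Sum>j\<in>UNIV. \<i> * (u $ j * h $ j) * f k)"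
    by (subst (1 2) sum.swap) (simp add: distrib_left sum.distrib sum_distrib_left mult_ac)
  also have "(\<Sum>j\<in>UNIV. v $ j * (\<i> * (\<Sum>l\<in>UNIV. cnj (A $ j $ l) * annih l f k) - (\<Sum>l\<in>UNIV. cnj (B $ j $ l) * creat l f k) + \<i> * cnj (h $ j) * f k))
    = (\<Sum>l\<in>UNIV. \<Sum>j\<in>UNIV. \<i> * (v $ j * cnj (A $ j $ l)) * annih l f k)
      - (\<Sum>l\<in>UNIV. \<Sum>j\<in>UNIV. v $ j * cnj (B $ j $ l) * creat l f k) + (\<Sum>j\<in>UNIV. \<i> * (v $ j * cnj (h $ j)) * f k)"
    by (subst (1 2) sum.swap) (simp add: distrib_left right_diff_distrib sum.distrib sum_subtractf sum_distrib_left mult_ac)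
  finally show ?thesis
    by (simp add: field_op_def vector_matrix_mult_def scalar_product_def cnj_mat_def cnj_vec_def
        distrib_right left_diff_distrib right_diff_distrib sum.distrib sum_subtractf sum_distrib_left
        sum_distrib_right distrib_left mult_ac)
qed

lemma field_op_derivative:
  assumes "\<And>j. ((\<lambda>t. u t $ j) has_vector_derivative u' $ j) (at t)"
    and "\<And>j. ((\<lambda>t. v t $ j) has_vector_derivative v' $ j) (at t)"
    and "(c has_vector_derivative c') (at t)"
    and "\<And>k. ((\<lambda>t. y t k) has_vector_derivative y' k) (at t)"
  shows "((\<lambda>t. field_op (u t) (v t) (c t) (y t) k) has_vector_derivative
    field_op (u t) (v t) (c t) y' k + field_op u' v' c' (y t) k) (at t)"
proof -
  have "((\<lambda>t. field_op (u t) (v t) (c t) (y t) k) has_vector_derivative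
    (\<Sum>j\<in>UNIV. u t $ j * annih j y' k + u' $ j * annih j (y t) k)
    + (\<Sum>j\<in>UNIV. v t $ j * creat j y' k + v' $ j * creat j (y t) k)
    + (c t * y' k + c' * y t k)) (at t)"
    unfolding field_op_def annih_def creat_def
    by (intro has_vector_derivative_add has_vector_derivative_sum has_vector_derivative_mult
        has_vector_derivative_mult_right assms)
  then show ?thesis by (simp add: field_op_def sum.distrib add_ac)
qed

section \<open>Growth of the operators with the total particle number\<close>

abbreviation total_number :: "('n::finite \<Rightarrow> nat) \<Rightarrow> nat" where
  "total_number k \<equiv> \<Sum>i\<in>UNIV. k i"

lemma total_number_upd: "total_number (k(i := a)) + k i = total_number k + a"
proof -
  have "total_number k = k i + sum k (UNIV - {i})" by (simp add: sum.remove)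
  moreover have "total_number (k(i := a)) = a + sum (k(i := a)) (UNIV - {i})"
    by (simp add: sum.remove[of UNIV i])
  moreover have "sum (k(i := a)) (UNIV - {i}) = sum k (UNIV - {i})" by (rule sum.cong) auto
  ultimately show ?thesis by simp
qed

lemma component_le_total_number: "k i \<le> total_number k"
  by (simp add: member_le_sum)

lemma
  assumes "\<And>l. total_number l \<le> m + 1 \<Longrightarrow> cmod (f l) \<le> b" "total_number k \<le> m"
  shows cmod_annih_le: "cmod (annih i f k) \<le> sqrt (real (m + 1)) * b"
    and cmod_creat_le: "cmod (creat i f k) \<le> sqrt (real (m + 1)) * b"
proof -
  have "k i \<le> m" using component_le_total_number[of k i] assms(2) by simp
  have "cmod (f (k(i := k i + 1))) \<le> b"
    using total_number_upd[of k i "k i + 1"] assms(2) by (intro assms(1)) simp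
  then show "cmod (annih i f k) \<le> sqrt (real (m + 1)) * b"
    unfolding annih_def norm_mult using \<open>k i \<le> m\<close>
    by (intro mult_mono) (auto intro: order_trans[OF norm_ge_zero])
  have "cmod (f (k(i := k i - 1))) \<le> b"
    using total_number_upd[of k i "k i - 1"] assms(2) by (intro assms(1)) simp
  then show "cmod (creat i f k) \<le> sqrt (real (m + 1)) * b"
    unfolding creat_def norm_mult using \<open>k i \<le> m\<close>
    by (intro mult_mono) (auto intro: order_trans[OF norm_ge_zero])
qed

lemma cmod_op_quad_le:
  assumes "X \<in> {annih, creat}" "Y \<in> {annih, creat}" "\<And>l. total_number l \<le> m + 2 \<Longrightarrow> cmod (f l) \<le> b" "total_number k \<le> m"
  shows "cmod (op_quad X M Y f k) \<le> (\<Sum>i\<in>UNIV. \<Sum>j\<in>UNIV. cmod (M $ i $ j)) * (real (m + 2) * b)"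
proof -
  have "b \<ge> 0" using assms(3)[of k] assms(4) by (auto intro: order_trans[OF norm_ge_zero])
  have inner: "cmod (Y j f l) \<le> sqrt (real (m + 1 + 1)) * b" if "total_number l \<le> m + 1" for l j
    using assms(2) cmod_annih_le[of "m + 1" f b l j] cmod_creat_le[of "m + 1" f b l j] assms(3) that by auto
  have "cmod (X i (Y j f) k) \<le> sqrt (real (m + 1)) * (sqrt (real (m + 1 + 1)) * b)" for i j
    using assms(1) cmod_annih_le[of m "Y j f" _ k i, OF inner assms(4)] cmod_creat_le[of m "Y j f" _ k i, OF inner assms(4)]
    by auto
  also have "\<dots> \<le> sqrt (real (m + 2)) * (sqrt (real (m + 2)) * b)"
    using \<open>b \<ge> 0\<close> by (intro mult_mono) auto
  also have "\<dots> = real (m + 2) * b" by (simp flip: mult.assoc)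
  finally have "cmod (X i (Y j f) k) \<le> real (m + 2) * b" for i j .
  then have "cmod (op_quad X M Y f k) \<le> (\<Sum>i\<in>UNIV. \<Sum>j\<in>UNIV. cmod (M $ i $ j) * (real (m + 2) * b))"
    unfolding op_quad_def by (intro sum_norm_le) (simp add: norm_mult mult_left_mono)
  then show ?thesis by (simp add: sum_distrib_right)
qed

lemma cmod_op_lin_le:
  assumes "X \<in> {annih, creat}" "\<And>l. total_number l \<le> m + 2 \<Longrightarrow> cmod (f l) \<le> b" "total_number k \<le> m"
  shows "cmod (op_lin X v f k) \<le> (\<Sum>i\<in>UNIV. cmod (v $ i)) * (real (m + 2) * b)"
proof -
  have "b \<ge> 0" using assms(2)[of k] assms(3) by (auto intro: order_trans[OF norm_ge_zero])
  have "cmod (X i f k) \<le> sqrt (real (m + 1)) * b" for i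
    using assms(1) cmod_annih_le[of m f b k i] cmod_creat_le[of m f b k i] assms(2,3) by auto
  also have "sqrt (real (m + 1)) * b \<le> real (m + 2) * b"
  proof (rule mult_right_mono)
    show "sqrt (real (m + 1)) \<le> real (m + 2)"
      by (rule real_le_lsqrt) (simp_all add: power2_eq_square algebra_simps)
  qed fact
  finally show ?thesis
    unfolding op_lin_def sum_distrib_right by (intro sum_norm_le) (simp add: norm_mult mult_left_mono)
qed

lemma ham_expr_bounded:
  fixes A B :: "complex^'n^('n::finite)"
  obtains K where "K > 0"
    "\<And>f k b. (\<And>l. total_number l \<le> total_number k + 2 \<Longrightarrow> cmod (f l) \<le> b) \<Longrightarrow>
      cmod (ham_expr A B h f k) \<le> K * real (total_number k + 2) * b"
proof
  let ?n = "\<lambda>M :: complex^'n^'n. \<Sum>i\<in>UNIV. \<Sum>j\<in>UNIV. cmod (M $ i $ j)"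
  let ?v = "\<lambda>v :: complex^'n. \<Sum>i\<in>UNIV. cmod (v $ i)"
  \<comment> \<open>The summand 1 keeps K positive even when all coefficients vanish.\<close>
  define K where "K = 1 / 2 * (?n A + ?n (cnj_mat A)) + ?n B + ?v h + ?v (cnj_vec h) + 1"
  show "K > 0"
    unfolding K_def by (intro add_nonneg_pos add_nonneg_nonneg mult_nonneg_nonneg sum_nonneg) auto
  have triangle: "cmod (\<i> / 2 * (P - Q) + R + \<i> * S - \<i> * T) \<le> 1 / 2 * (cmod P + cmod Q) + cmod R + cmod S + cmod T"
    for P Q R S T
  proof -
    have "cmod (\<i> / 2 * (P - Q) + R + \<i> * S - \<i> * T)
        \<le> cmod (\<i> / 2 * (P - Q)) + cmod R + cmod (\<i> * S) + cmod (\<i> * T)"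
      by (intro order_trans[OF norm_triangle_ineq4] add_right_mono order_trans[OF norm_triangle_ineq] order_refl)
    also have "cmod (\<i> / 2 * (P - Q)) = 1 / 2 * cmod (P - Q)" by (simp add: norm_mult norm_divide)
    also have "1 / 2 * cmod (P - Q) \<le> 1 / 2 * (cmod P + cmod Q)"
      by (intro mult_left_mono norm_triangle_ineq4) simp
    finally show ?thesis by (simp add: norm_mult)
  qed
  fix f :: "('n \<Rightarrow> nat) \<Rightarrow> complex" and k :: "'n \<Rightarrow> nat" and b
  assume f: "\<And>l. total_number l \<le> total_number k + 2 \<Longrightarrow> cmod (f l) \<le> b"
  have "b \<ge> 0" using f[of k] by (auto intro: order_trans[OF norm_ge_zero])
  define c where "c = real (total_number k + 2) * b"
  note quad = cmod_op_quad_le[where f = f and k = k and m = "total_number k" and b = b, OF _ _ f order_refl, folded c_def]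
  note lin = cmod_op_lin_le[where f = f and k = k and m = "total_number k" and b = b, OF _ f order_refl, folded c_def]
  have "cmod (ham_expr A B h f k)
      \<le> 1 / 2 * (?n A * c + ?n (cnj_mat A) * c) + ?n B * c + ?v h * c + ?v (cnj_vec h) * c"
    unfolding ham_expr_def
    by (rule order_trans[OF triangle], intro add_mono mult_left_mono quad lin) auto
  also have "\<dots> \<le> K * c"
    using mult_nonneg_nonneg[OF of_nat_0_le_iff \<open>b \<ge> 0\<close>, of "total_number k + 2", folded c_def]
    unfolding K_def distrib_right mult.assoc by simp
  finally show "cmod (ham_expr A B h f k) \<le> K * real (total_number k + 2) * b"
    unfolding c_def mult.assoc .
qed

section \<open>The evolved vacuum\<close>

lemma field_op_mult:
  "field_op u v c (\<lambda>k. a * f k) k = a * field_op u v c f k"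
  "field_op (a *s u) (a *s v) (a * c) f k = a * field_op u v c f k"
  by (simp_all add: field_op_def annih_linear creat_linear distrib_left sum_distrib_left mult_ac)

lemma field_op_flow_derivative:
  fixes p :: "'n::finite"
  assumes "A = transpose A" "B = cnj_mat (transpose B)"
    and y: "\<And>k. ((\<lambda>t. y t k) has_vector_derivative \<i> * ham_expr A B h (y t) k) (at t)"
  defines "x \<equiv> \<lambda>t. field_op (row p (Phi A B t)) (row p (Psi A B t)) (h_vec A B h t $ p) (y t)"
  shows "((\<lambda>t. x t k) has_vector_derivative \<i> * ham_expr A B h (x t) k) (at t)"
proof -
  let ?u = "row p (Phi A B t)" and ?v = "row p (Psi A B t)"
  let ?w1 = "?u v* B + \<i> *s (?v v* cnj_mat A)" and ?w2 = "\<i> *s (?u v* A) - ?v v* cnj_mat B"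
    and ?w3 = "\<i> * (scalar_product ?u h + scalar_product ?v (cnj_vec h))"
  have u': "((\<lambda>t. row p (Phi A B t) $ j) has_vector_derivative (- \<i> *s ?w1) $ j) (at t)" for j
    using flow_derivative_right[of A B "Inl p" "Inl j" t UNIV]
    by (simp add: row_def Phi_def Psi_def sum_UNIV_Plus G_mat_def vector_matrix_mult_def cnj_mat_def
        algebra_simps sum_negf sum_distrib_left)
  have v': "((\<lambda>t. row p (Psi A B t) $ j) has_vector_derivative (- \<i> *s ?w2) $ j) (at t)" for j
    using flow_derivative_right[of A B "Inl p" "Inr j" t UNIV]
    by (simp add: row_def Phi_def Psi_def sum_UNIV_Plus G_mat_def vector_matrix_mult_def cnj_mat_def
        algebra_simps sum_negf sum_distrib_left)
  have c': "((\<lambda>t. h_vec A B h t $ p) has_vector_derivative - \<i> * ?w3) (at t)"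
    using flow_integral_derivative[of A B h "Inl p" t]
    by (simp add: h_vec_nth row_def Phi_def Psi_def sum_UNIV_Plus scalar_product_def doubled_def cnj_vec_def
        add.commute)
  have "((\<lambda>t. x t k) has_vector_derivative
      field_op ?u ?v (h_vec A B h t $ p) (\<lambda>k. \<i> * ham_expr A B h (y t) k) k
      + field_op (- \<i> *s ?w1) (- \<i> *s ?w2) (- \<i> * ?w3) (y t) k) (at t)"
    unfolding x_def by (rule field_op_derivative[OF u' v' c' y])
  then show ?thesis
    unfolding field_op_mult field_op_ham_expr[OF assms(1,2)] x_def by (simp add: algebra_simps)
qed

lemma sqrt_of_nat_le: "sqrt (real n) \<le> real n"
  by (rule real_le_lsqrt) (auto simp: power2_eq_square simp flip: of_nat_mult)

lemma cmod_field_op_le: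
  assumes "\<And>l. cmod (f l) \<le> 1"
  shows "cmod (field_op u v c f k)
    \<le> ((\<Sum>j\<in>UNIV. cmod (u $ j)) + (\<Sum>j\<in>UNIV. cmod (v $ j)) + cmod c) * real (total_number k + 1)"
proof -
  let ?m = "real (total_number k + 1)"
  have "sqrt ?m \<le> ?m" by (rule sqrt_of_nat_le)
  then have le: "cmod (annih j f k) \<le> ?m" "cmod (creat j f k) \<le> ?m" for j
    using cmod_annih_le[of "total_number k" f 1 k j] cmod_creat_le[of "total_number k" f 1 k j] assms by fastforce+
  have "cmod (field_op u v c f k)
      \<le> cmod (\<Sum>j\<in>UNIV. u $ j * annih j f k) + cmod (\<Sum>j\<in>UNIV. v $ j * creat j f k) + cmod (c * f k)"
    unfolding field_op_def by (intro order_trans[OF norm_triangle_ineq] add_right_mono order_refl)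
  also have "\<dots> \<le> (\<Sum>j\<in>UNIV. cmod (u $ j) * ?m) + (\<Sum>j\<in>UNIV. cmod (v $ j) * ?m) + cmod c * ?m"
  proof (intro add_mono sum_norm_le)
    show "cmod (c * f k) \<le> cmod c * ?m"
      unfolding norm_mult
      by (intro mult_left_mono order_trans[OF assms]) (simp_all del: of_nat_sum)
    show "cmod (u $ j * annih j f k) \<le> cmod (u $ j) * ?m" for j
      unfolding norm_mult by (intro mult_left_mono le norm_ge_zero)
    show "cmod (v $ j * creat j f k) \<le> cmod (v $ j) * ?m" for j
      unfolding norm_mult by (intro mult_left_mono le norm_ge_zero)
  qed
  finally show ?thesis by (simp add: sum_distrib_right distrib_right del: of_nat_add)
qed

lemma field_op_flow_vacuum:
  fixes U :: "real \<Rightarrow> ('n::finite) fock \<Rightarrow> 'n fock"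
  assumes "A = transpose A" "B = cnj_mat (transpose B)" "is_exp_i (ham A B h) U"
  shows "field_op (row p (Phi A B t)) (row p (Psi A B t)) (h_vec A B h t $ p) (amp (U t vacuum)) k = 0"
proof -
  define x where "x = (\<lambda>t. field_op (row p (Phi A B t)) (row p (Psi A B t)) (h_vec A B h t $ p) (amp (U t vacuum)))"
  have grp: "unitary_group U" using assms(3) by (simp add: is_exp_i_def)
  obtain K where "K > 0" and K: "\<And>f k b. (\<And>l. total_number l \<le> total_number k + 2 \<Longrightarrow> cmod (f l) \<le> b) \<Longrightarrow>
      cmod (ham_expr A B h f k) \<le> K * real (total_number k + 2) * b"
    using ham_expr_bounded by blast
  have "x t k = 0"
  proof (rule banded_ode_unique[where x = x and sz = total_number and K = K])
    show "((\<lambda>t. x t k) has_vector_derivative \<i> * ham_expr A B h (x t) k) (at t)" for t k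
      unfolding x_def
      by (rule field_op_flow_derivative[OF assms(1,2)]) (rule amp_group_derivative[OF assms(3,2)])
    show "cmod (\<i> * ham_expr A B h (x t) k) \<le> K * real (total_number k + 2) * b"
      if "\<And>l. total_number l \<le> total_number k + 2 \<Longrightarrow> cmod (x t l) \<le> b" for t k b
      using K[OF that] by (simp add: norm_mult)
    show "\<exists>C\<ge>0. \<forall>t k. \<bar>t\<bar> \<le> T \<longrightarrow> cmod (x t k) \<le> C * real (total_number k + 1)" for T
    proof -
      define c where "c = (\<lambda>t. (\<Sum>j\<in>UNIV. cmod (row p (Phi A B t) $ j)) + (\<Sum>j\<in>UNIV. cmod (row p (Psi A B t) $ j))
        + cmod (h_vec A B h t $ p))"
      \<comment> \<open>The amplitudes of the evolved vacuum are bounded by 1 at all times, so the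
        growth constant on [-T, T] only has to bound the coefficients, which are continuous in
        t.\<close>
      have "continuous_on {-T..T} c"
        unfolding c_def row_def Phi_def Psi_def vec_lambda_beta by (intro continuous_intros)
      then have "bounded (c ` {-T..T})"
        by (intro compact_imp_bounded compact_continuous_image) auto
      then obtain C where "C > 0" and C: "\<And>t. t \<in> {-T..T} \<Longrightarrow> norm (c t) \<le> C"
        unfolding bounded_pos by blast
      have "cmod (x t k) \<le> C * real (total_number k + 1)" if "\<bar>t\<bar> \<le> T" for t k
      proof -
        have "cmod (x t k) \<le> c t * real (total_number k + 1)"
          unfolding x_def c_def
          by (rule cmod_field_op_le)
            (use cmod_amp_group_le[OF grp, of _ vacuum] in \<open>simp add: norm_vacuum\<close>)
        also have "\<dots> \<le> C * real (total_number k + 1)"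
        proof (rule mult_right_mono)
          show "c t \<le> C" using C[of t] that by (simp add: abs_le_iff)
        qed (rule of_nat_0_le_iff)
        finally show ?thesis .
      qed
      with \<open>C > 0\<close> show ?thesis by (intro exI[of _ C]) auto
    qed
    show "x 0 k = 0" for k
    proof -
      have "U 0 = id" using grp by (simp add: unitary_group_def)
      moreover have "annih j (\<lambda>k. if k = (\<lambda>_. 0) then 1 else 0) k = 0" for j
        by (auto simp: annih_def fun_upd_def dest: fun_cong[of _ _ j])
      ultimately show ?thesis
        by (simp add: x_def field_op_def amp_vacuum row_def Psi_def flow_zero mat_def h_vec_nth flow_integral_zero)
    qed
  qed fact
  then show ?thesis by (simp add: x_def)
qed

lemma annih_vacuum_evolution:
  fixes U :: "real \<Rightarrow> ('n::finite) fock \<Rightarrow> 'n fock"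
  assumes "A = transpose A" "B = cnj_mat (transpose B)" "is_exp_i (ham A B h) U"
  shows "annih j (amp (U t vacuum)) = (\<lambda>k. f_tilde A B h t $ j * amp (U t vacuum) k
    - (\<Sum>l\<in>UNIV. R_mat A B t $ j $ l * creat l (amp (U t vacuum)) k))"
proof
  fix k
  let ?y = "amp (U t vacuum)"
  \<comment> \<open>At a fixed occupation \<open>k\<close> the values over all modes form ordinary
    vectors, so solving for the annihilation part is linear algebra with
    \<open>Phi A B t\<close>.\<close>
  let ?a = "\<chi> j. annih j ?y k" and ?c = "\<chi> j. creat j ?y k"
  have det: "det (Phi A B t) \<noteq> 0" by (rule det_Phi_nonzero[OF assms(1,2)])
  have "(Phi A B t *v ?a + Psi A B t *v ?c + ?y k *s h_vec A B h t) $ p = 0" for p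
    using field_op_flow_vacuum[OF assms, of p t k]
    by (simp add: field_op_def matrix_vector_mult_def row_def mult.commute)
  then have "Phi A B t *v ?a + Psi A B t *v ?c + ?y k *s h_vec A B h t = 0"
    by (simp add: vec_eq_iff)
  moreover have "Psi A B t *v ?c = Phi A B t *v (R_mat A B t *v ?c)"
    by (simp add: matrix_vector_mul_assoc Phi_R_mat[OF det])
  moreover have "?y k *s h_vec A B h t = - (Phi A B t *v (?y k *s f_tilde A B h t))"
    by (simp add: vector_scalar_commute Phi_f_tilde[OF det] vector_smult_rneg)
  ultimately have "Phi A B t *v ?a = Phi A B t *v (?y k *s f_tilde A B h t - R_mat A B t *v ?c)"
    by (simp add: matrix_vector_mult_diff_distrib algebra_simps)
  moreover have "inj ((*v) (Phi A B t))"
    using det by (intro inj_matrix_vector_mult) (simp add: invertible_det_nz)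
  ultimately have "?a = ?y k *s f_tilde A B h t - R_mat A B t *v ?c"
    by (simp add: inj_eq)
  from arg_cong[OF this, of "\<lambda>v. v $ j"]
  show "annih j ?y k = f_tilde A B h t $ j * ?y k - (\<Sum>l\<in>UNIV. R_mat A B t $ j $ l * creat l ?y k)"
    by (simp add: matrix_vector_mult_def mult.commute)
qed

lemma vacuum_amplitude_derivative:
  fixes U :: "real \<Rightarrow> ('n::finite) fock \<Rightarrow> 'n fock"
  assumes "A = transpose A" "B = cnj_mat (transpose B)" "is_exp_i (ham A B h) U"
  shows "((\<lambda>t. braket vacuum (U t vacuum)) has_vector_derivative
    (scalar_product (f_tilde A B h t) (cnj_vec h)
      + 1 / 2 * scalar_product (f_tilde A B h t) (cnj_mat A *v f_tilde A B h t)
      - 1 / 2 * trace (R_mat A B t ** cnj_mat A)) * braket vacuum (U t vacuum)) (at t)"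
proof -
  let ?y = "amp (U t vacuum)" and ?f = "f_tilde A B h t" and ?R = "R_mat A B t" and ?z = "\<lambda>_ :: 'n. 0 :: nat"
  note a = annih_vacuum_evolution[OF assms, where t = t]
  \<comment> \<open>At zero occupation every term with a leading creation operator drops out, so
    only the purely annihilating part of the Hamiltonian contributes.\<close>
  have creat0: "creat i g ?z = 0" for i g by (simp add: creat_def)
  have a1: "annih i ?y ?z = ?f $ i * ?y ?z" for i
    by (subst a) (simp add: creat0)
  \<comment> \<open>Applying the second annihilation operator to the creation terms leaves only the
    commutator, the entry \<open>?R $ j $ i\<close>. This is the origin of the trace.\<close>
  have a2: "annih i (annih j ?y) ?z = (?f $ i * ?f $ j - ?R $ j $ i) * ?y ?z" for i j
    by (subst a, simp add: annih_linear annih_creat creat0 a1 if_distrib[of "\<lambda>x. _ * x"] cong: if_cong)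
      (simp add: algebra_simps)
  have "\<i> * ham_expr A B h ?y ?z =
      1 / 2 * (\<Sum>i\<in>UNIV. \<Sum>j\<in>UNIV. cnj (A $ i $ j) * ((?f $ i * ?f $ j - ?R $ j $ i) * ?y ?z))
      + (\<Sum>i\<in>UNIV. cnj (h $ i) * (?f $ i * ?y ?z))"
    by (simp add: ham_expr_def op_quad_def op_lin_def creat0 a1 a2 cnj_mat_def cnj_vec_def algebra_simps)
  also have "\<dots> = (1 / 2 * ((\<Sum>i\<in>UNIV. \<Sum>j\<in>UNIV. cnj (A $ i $ j) * ?f $ i * ?f $ j)
      - (\<Sum>i\<in>UNIV. \<Sum>j\<in>UNIV. cnj (A $ i $ j) * ?R $ j $ i)) + (\<Sum>i\<in>UNIV. cnj (h $ i) * ?f $ i)) * ?y ?z"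
    by (simp add: algebra_simps sum_subtractf sum_distrib_left sum_distrib_right)
  also have "(\<Sum>i\<in>UNIV. \<Sum>j\<in>UNIV. cnj (A $ i $ j) * ?R $ j $ i) = trace (?R ** cnj_mat A)"
    by (subst sum.swap) (simp add: trace_def matrix_matrix_mult_def cnj_mat_def mult.commute)
  also have "(\<Sum>i\<in>UNIV. \<Sum>j\<in>UNIV. cnj (A $ i $ j) * ?f $ i * ?f $ j) = scalar_product ?f (cnj_mat A *v ?f)"
    by (simp add: scalar_product_def matrix_vector_mult_def cnj_mat_def sum_distrib_left mult_ac)
  also have "(\<Sum>i\<in>UNIV. cnj (h $ i) * ?f $ i) = scalar_product ?f (cnj_vec h)"
    by (simp add: scalar_product_def cnj_vec_def mult.commute)
  finally have "((\<lambda>t. amp (U t vacuum) ?z) has_vector_derivative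
      (1 / 2 * (scalar_product ?f (cnj_mat A *v ?f) - trace (?R ** cnj_mat A))
        + scalar_product ?f (cnj_vec h)) * ?y ?z) (at t)"
    using amp_group_derivative[OF assms(3,2), of vacuum ?z t] by simp
  then show ?thesis by (simp add: braket_vacuum algebra_simps)
qed

text \<open>Integrating factor: F exp(- S) is constant, with S the integral of \<open>g\<close>.
  There is no division by \<open>F\<close>, whose nonvanishing comes out as a consequence.\<close>

lemma exp_integral_unique:
  fixes F g :: "real \<Rightarrow> complex"
  assumes F: "\<And>t. (F has_vector_derivative g t * F t) (at t)" and "F 0 = 1" and g: "continuous_on UNIV g"
  shows "exp (LBINT \<tau>=0..ereal t. g \<tau>) = F t"
proof -
  let ?S = "\<lambda>t. LBINT \<tau>=0..ereal t. g \<tau>"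
  have "((\<lambda>t. F t * exp (- ?S t)) has_vector_derivative 0) (at t)" for t
  proof -
    have "((\<lambda>t. - ?S t) has_vector_derivative - g t) (at t)"
      by (intro has_vector_derivative_minus interval_integral_has_vector_derivative g)
    then have "((exp \<circ> (\<lambda>t. - ?S t)) has_vector_derivative - g t * exp (- ?S t)) (at t)"
      by (rule field_vector_diff_chain_at) (rule DERIV_exp)
    from has_vector_derivative_mult[OF F this] show ?thesis by (simp add: o_def)
  qed
  from has_vector_derivative_zero_imp_eq[OF this, of t 0]
  have "F t * exp (- ?S t) = 1" using \<open>F 0 = 1\<close> by (simp flip: zero_ereal_def)
  then show ?thesis by (simp add: exp_minus field_simps)
qed

text \<open>Two logarithms of the same function differ by integer multiples of 2 pi i. A continuous
  function on the line with such a discrete range is constant.\<close>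

lemma continuous_logarithm_unique:
  fixes s S :: "real \<Rightarrow> complex"
  assumes "continuous_on UNIV s" "continuous_on UNIV S" "s 0 = S 0" "\<And>t. exp (s t) = exp (S t)"
  shows "s t = S t"
proof -
  let ?d = "\<lambda>t. s t - S t"
  have ex: "\<exists>n::int. ?d t = of_int n * (of_real (2 * pi) * \<i>)" for t
    using assms(4)[of t] by (auto simp: exp_eq algebra_simps)
  have "?d constant_on UNIV"
  proof (rule continuous_discrete_range_constant)
    fix x
    have "2 * pi \<le> norm (?d y - ?d x)" if "?d y \<noteq> ?d x" for y
    proof -
      obtain m n :: int where mn: "?d x = of_int m * (of_real (2 * pi) * \<i>)" "?d y = of_int n * (of_real (2 * pi) * \<i>)"
        using ex by metis
      then have "?d y - ?d x = of_int (n - m) * (of_real (2 * pi) * \<i>)" by (simp only: of_int_diff left_diff_distrib)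
      then have "norm (?d y - ?d x) = of_int \<bar>n - m\<bar> * (2 * pi)"
        by (simp add: norm_mult del: of_int_diff)
      moreover have "\<bar>n - m\<bar> \<ge> 1" using mn that by auto
      then have "real_of_int \<bar>n - m\<bar> \<ge> 1" by linarith
      ultimately show ?thesis using mult_right_mono[of 1 "real_of_int \<bar>n - m\<bar>" "2 * pi"] by simp
    qed
    then show "\<exists>e>0. \<forall>y. y \<in> UNIV \<and> ?d y \<noteq> ?d x \<longrightarrow> e \<le> norm (?d y - ?d x)"
      by (intro exI[of _ "2 * pi"]) auto
  qed (auto intro: continuous_on_diff assms)
  then obtain c where "\<And>t. ?d t = c" unfolding constant_on_def by blast
  then have "?d t = ?d 0" by simp
  then show ?thesis using assms(3) by simp
qed


theorem mainTheorem5: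
  fixes A B :: "complex^'n^'n" and h :: "complex^'n"
    and U :: "real \<Rightarrow> ('n::finite) fock \<Rightarrow> 'n fock"
    and s :: "real \<Rightarrow> complex"
  assumes "A = transpose A"
    and "B = cnj_mat (transpose B)"
    and "is_exp_i (ham A B h) U"
  shows "(continuous_on UNIV s \<and> s 0 = 0 \<and> (\<forall>t. exp (s t) = braket vacuum (U t vacuum)))
    \<longleftrightarrow> (\<forall>t. s t = (LBINT \<tau>=0..t.
            scalar_product (f_tilde A B h \<tau>) (cnj_vec h)
          + 1 / 2 * scalar_product (f_tilde A B h \<tau>) (cnj_mat A *v f_tilde A B h \<tau>)
          - 1 / 2 * trace (R_mat A B \<tau> ** cnj_mat A)))"
proof -
  define g where "g = (\<lambda>\<tau>. scalar_product (f_tilde A B h \<tau>) (cnj_vec h)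
    + 1 / 2 * scalar_product (f_tilde A B h \<tau>) (cnj_mat A *v f_tilde A B h \<tau>)
    - 1 / 2 * trace (R_mat A B \<tau> ** cnj_mat A))"
  define S where "S = (\<lambda>t. LBINT \<tau>=0..ereal t. g \<tau>)"
  have det: "det (Phi A B t) \<noteq> 0" for t by (rule det_Phi_nonzero[OF assms(1,2)])
  have g: "continuous_on UNIV g"
    unfolding g_def scalar_product_def trace_def matrix_matrix_mult_def matrix_vector_mult_def vec_lambda_beta
    by (intro continuous_intros continuous_on_R_mat continuous_on_f_tilde det)
  have "U 0 vacuum = vacuum"
    using assms(3) by (simp add: is_exp_i_def unitary_group_def)
  then have F0: "braket vacuum (U 0 vacuum) = 1" by (simp add: braket_vacuum amp_vacuum)
  have F': "((\<lambda>t. braket vacuum (U t vacuum)) has_vector_derivative g t * braket vacuum (U t vacuum)) (at t)" for t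
    unfolding g_def by (rule vacuum_amplitude_derivative[OF assms])
  have "exp (S t) = braket vacuum (U t vacuum)" for t
    unfolding S_def by (rule exp_integral_unique[OF F' F0 g])
  moreover have "continuous_on UNIV S"
    unfolding S_def
    by (rule continuous_on_vector_derivative) (rule has_vector_derivative_at_within,
        rule interval_integral_has_vector_derivative[OF g])
  moreover have "S 0 = 0" by (simp add: S_def flip: zero_ereal_def)
  \<comment> \<open>The integral \<open>S\<close> is itself a continuous logarithm starting at 0,
    and uniqueness makes it the only one; this gives both directions of the equivalence.\<close>
  ultimately have "(continuous_on UNIV s \<and> s 0 = 0 \<and> (\<forall>t. exp (s t) = braket vacuum (U t vacuum)))
      \<longleftrightarrow> (\<forall>t. s t = S t)"
    using continuous_logarithm_unique[of s S] by (metis ext)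
  then show ?thesis by (simp only: S_def g_def)
qed

end
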